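(* Let $X=[-1,1]$ and let $\alpha,\beta>-1$. Let $\{x_i\}_{i=1}^n\subset X$ be i.i.d. random samples with respect to the Jacobi weight function $w(x)=c(1-x)^\alpha(1+x)^\beta$, $c=\left(\int_{-1}^1(1-x)^\alpha(1+x)^\beta\,dx\right)^{-1}$, i.e. drawn from the probability measure $\rho_X$ with $d\rho_X=w(x)\,dx$. Let $P_m^n$ be the discrete polynomial least squares projection onto $\mathbb{P}_m$ based on these samples, and $\kappa_2(P_m^n)$ its condition number. Assume that $$n\asymp m^{1/\tau},\qquad 0<\tau\le 1,$$ with $m<n$. If $\gamma:=\max\{\alpha,\beta\}>-1/2$ and $$\tau>\frac{1}{2(1+\gamma)},$$ then for any $s\in\mathbb{R}$ with $0<s<2(1+\gamma)\tau-1$ and all large $n$, the following holds with probability at least $1-\frac{2e^2\bar c}{n^s}$: $$\kappa_2(P_m^n)\ \ge\ \frac{\eta}{n^{(1+\gamma)\tau}}\,\nu^{n^r},\qquad r=\frac{2(1+\gamma)\tau-1-s}{1+2\gamma}.$$ Here $\bar c=\frac{c\cdot 2^{\min\{\alpha,\beta\}}}{1+\gamma}$, and $\eta>0$, $\nu>1$ are constants depending on $\alpha,\beta$ and the implicit constants in $n\asymp m^{1/\tau}$.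
   Context: $\mathbb{P}_m$ is the space of univariate algebraic polynomials of degree at most $m$. $\|f\|:=\left(\int_X|f(x)|^2\,d\rho_X(x)\right)^{1/2}$ is the $L^2(X,\rho_X)$ norm, and $\|f\|_{n,2}:=\left(\frac1n\sum_{i=1}^n|f(x_i)|^2\right)^{1/2}$ is the empirical semi-norm. The discrete least squares projection is $P_m^n(f):=\arg\min_{p\in\mathbb{P}_m}\|p-f\|_{n,2}$; for $m<n$ it is almost surely uniquely defined. Its condition number is $$\kappa_2(P_m^n):=\sup_{h:X\to\mathbb{R},\ \|h\|_{n,2}\ne0}\frac{\|P_m^n(h)\|}{\|h\|_{n,2}}.$$ The notation $n\asymp m^{1/\tau}$ means that $m=m(n)$ is such that there are positive constants $a_1,a_2$ (the implicit constants) with $a_1m^{1/\tau}\le n\le a_2m^{1/\tau}$ for all large $n$. $e$ is the base of the natural logarithm. *)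

theory Defs
  imports "HOL-Probability.Probability" "HOL-Computational_Algebra.Polynomial"
begin

definition jacobi_const :: "real \<Rightarrow> real \<Rightarrow> real" where
  "jacobi_const \<alpha> \<beta> =
     inverse (set_lebesgue_integral lborel {-1..1} (\<lambda>x. (1 - x) powr \<alpha> * (1 + x) powr \<beta>))"

(* At an endpoint, 0 powr a = 0 also for a <= 0; this only changes w on a null set. *)
definition jacobi_weight :: "real \<Rightarrow> real \<Rightarrow> real \<Rightarrow> real" where
  "jacobi_weight \<alpha> \<beta> x = jacobi_const \<alpha> \<beta> * (1 - x) powr \<alpha> * (1 + x) powr \<beta>"

(* The underlying space is X = [-1,1] itself, so samples lie in X. *)
definition jacobi_measure :: "real \<Rightarrow> real \<Rightarrow> real measure" where
  "jacobi_measure \<alpha> \<beta> =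
     density (restrict_space lborel {-1..1}) (\<lambda>x. ennreal (jacobi_weight \<alpha> \<beta> x))"

(* The joint law of n i.i.d. samples x 1, ..., x n. *)
definition sample_measure :: "real \<Rightarrow> real \<Rightarrow> nat \<Rightarrow> (nat \<Rightarrow> real) measure" where
  "sample_measure \<alpha> \<beta> n = (\<Pi>\<^sub>M i\<in>{1..n}. jacobi_measure \<alpha> \<beta>)"

definition L2_norm :: "real measure \<Rightarrow> (real \<Rightarrow> real) \<Rightarrow> real" where
  "L2_norm \<rho> f = sqrt (\<integral>x. \<bar>f x\<bar>\<^sup>2 \<partial>\<rho>)"

definition emp_norm :: "nat \<Rightarrow> (nat \<Rightarrow> real) \<Rightarrow> (real \<Rightarrow> real) \<Rightarrow> real" where
  "emp_norm n x f = sqrt (1 / real n * (\<Sum>i\<in>{1..n}. \<bar>f (x i)\<bar>\<^sup>2))"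

(* If the minimizer is not unique (fewer than m + 1 distinct sample points), arg_min picks
   an unspecified one; for m < n this concerns a null set of samples only. *)
definition lsq_proj :: "nat \<Rightarrow> nat \<Rightarrow> (nat \<Rightarrow> real) \<Rightarrow> (real \<Rightarrow> real) \<Rightarrow> real poly" where
  "lsq_proj m n x f = arg_min (\<lambda>p. emp_norm n x (\<lambda>t. poly p t - f t)) (\<lambda>p. degree p \<le> m)"

(* Functions h on X are represented by functions on the reals; only their values at the
   sample points matter.  The supremum is extended-real-valued, so it is meaningful without
   a boundedness argument. *)
definition cond_number ::
  "real measure \<Rightarrow> nat \<Rightarrow> nat \<Rightarrow> (nat \<Rightarrow> real) \<Rightarrow> ereal" where
  "cond_number \<rho> m n x =
     (SUP h\<in>{h :: real \<Rightarrow> real. emp_norm n x h \<noteq> 0}.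
        ereal (L2_norm \<rho> (poly (lsq_proj m n x h)) / emp_norm n x h))"

end

theory Submission imports Defs begin

text \<open>
  Let \<open>\<sigma>\<close> be the endpoint where the weight has the exponent \<open>\<gamma>\<close>. By Markov's inequality, with the
  stated probability at most \<open>k \<approx> n powr r\<close> samples lie within distance \<open>d\<close> of \<open>\<sigma>\<close>, where
  \<open>d powr (1 + \<gamma>) = k * n powr (-(1 + s))\<close>; almost surely all samples are distinct, so that the
  projection reproduces \<open>\<P>\<^sub>m\<close>. Take the polynomial that vanishes at these samples and is otherwise
  the power \<open>4 * k\<close> of a Dirichlet kernel (a polynomial of degree \<open>N\<close>, proportional to \<open>1 / sqrt d\<close>,
  in \<open>cos \<theta>\<close>) peaking at \<open>\<sigma>\<close>. At distance \<open>t \<ge> d\<close> from \<open>\<sigma>\<close> the zeros contribute at most \<open>t ^ k\<close> and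
  the kernel at most \<open>(4 / t\<^sup>2) ^ k\<close>, so the polynomial is at most \<open>(4 / d) ^ k\<close> at the samples. Within
  distance about \<open>1 / N\<^sup>2\<close> of \<open>\<sigma>\<close> the kernel contributes \<open>N ^ (4 * k)\<close>, and a monic polynomial of degree
  \<open>k\<close> is at least \<open>(const / N\<^sup>2) ^ k\<close> on half of that interval. Hence the ratio of the norms is, up to
  \<open>N powr (-(1 + \<gamma>))\<close>, at least \<open>(const * N\<^sup>2 * d) ^ k\<close>, and \<open>N\<^sup>2 * d\<close> can be made a large constant.
\<close>

section \<open>The Dirichlet kernel as an algebraic polynomial\<close>

lemma abs_sin_nat_mult_le: "\<bar>sin (real j * t)\<bar> \<le> real j * \<bar>sin t\<bar>"
proof (induction j)
  case (Suc j)
  have "\<bar>sin (real (Suc j) * t)\<bar> \<le> \<bar>sin (real j * t) * cos t\<bar> + \<bar>cos (real j * t) * sin t\<bar>"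
    using abs_triangle_ineq[of "sin (real j * t) * cos t" "cos (real j * t) * sin t"]
    by (simp add: distrib_right sin_add algebra_simps)
  also have "\<dots> \<le> \<bar>sin (real j * t)\<bar> * 1 + 1 * \<bar>sin t\<bar>"
    unfolding abs_mult by (intro add_mono mult_left_mono mult_right_mono) auto
  also have "\<dots> \<le> real (Suc j) * \<bar>sin t\<bar>"
    using Suc by (simp add: algebra_simps)
  finally show ?case .
qed simp

lemma cos_eq_one_minus_sin_half: "cos t = 1 - 2 * (sin (t / 2))\<^sup>2" for t :: real
  using cos_double_sin[of "t / 2"] by simp

text \<open>By 1 - cos t = 2 sin(t/2)^2 this reduces to the preceding bound on sines. It will keep
  every cosine of the kernel at least 1/2 near the peak.\<close>

lemma cos_nat_mult_ge: "cos (real j * t) \<ge> 1 - (real j)\<^sup>2 * (1 - cos t)"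
proof -
  have "\<bar>sin (real j * (t / 2))\<bar>\<^sup>2 \<le> (real j * \<bar>sin (t / 2)\<bar>)\<^sup>2"
    by (intro power_mono abs_sin_nat_mult_le) simp
  then have "(sin (real j * t / 2))\<^sup>2 \<le> (real j)\<^sup>2 * (sin (t / 2))\<^sup>2"
    by (simp add: power_mult_distrib)
  then show ?thesis
    using cos_eq_one_minus_sin_half[of t] cos_eq_one_minus_sin_half[of "real j * t"] by simp
qed

text \<open>These are the Chebyshev polynomials of the fourth kind: the value at cos t is sin((N +
  1/2) t) / sin(t/2), the Dirichlet kernel. The recursion makes the degree bound immediate.\<close>

fun dirichlet_poly :: "nat \<Rightarrow> real poly" where
  "dirichlet_poly 0 = 1"
| "dirichlet_poly (Suc 0) = [:1, 2:]"
| "dirichlet_poly (Suc (Suc N)) = [:0, 2:] * dirichlet_poly (Suc N) - dirichlet_poly N"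

lemma degree_dirichlet_poly: "degree (dirichlet_poly N) \<le> N"
proof (induction N rule: dirichlet_poly.induct)
  case (3 N)
  have "degree ([:0, 2:] * dirichlet_poly (Suc N)) \<le> Suc (Suc N)"
    using degree_mult_le[of "[:0, 2 :: real:]" "dirichlet_poly (Suc N)"] 3 by simp
  then show ?case
    using 3 by (simp only: dirichlet_poly.simps) (rule degree_diff_le; simp)
qed simp_all

lemma poly_dirichlet_poly_cos:
  "poly (dirichlet_poly N) (cos t) = 1 + 2 * (\<Sum>j=1..N. cos (real j * t))"
proof (induction N rule: dirichlet_poly.induct)
  case (3 N)
  \<comment> \<open>Multiplying the cosine sum by 2 cos t gives one copy shifted up and one shifted
    down. Doubled, the lower copy cancels the subtracted kernel up to the constant 1; the term cos t
    missing from the upper copy comes from the leading 1.\<close>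
  have *: "2 * cos t * cos (real j * t) = cos (real (Suc j) * t) + cos ((real j - 1) * t)" for j
    by (simp add: distrib_right left_diff_distrib cos_add cos_diff)
  have "2 * cos t * (\<Sum>j=1..Suc N. cos (real j * t))
      = (\<Sum>j=1..Suc N. cos (real (Suc j) * t)) + (\<Sum>j=1..Suc N. cos ((real j - 1) * t))"
    by (simp only: sum_distrib_left * sum.distrib)
  also have "(\<Sum>j=1..Suc N. cos ((real j - 1) * t)) = (\<Sum>j=0..N. cos (real j * t))"
    by (rule sum.reindex_bij_witness[of _ Suc "\<lambda>j. j - 1"]) auto
  also have "\<dots> = 1 + (\<Sum>j=1..N. cos (real j * t))"
    by (subst sum.atLeast_Suc_atMost) auto
  also have "(\<Sum>j=1..Suc N. cos (real (Suc j) * t)) = (\<Sum>j=2..Suc (Suc N). cos (real j * t))"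
    by (rule sum.reindex_bij_witness[of _ "\<lambda>j. j - 1" Suc]) auto
  finally have A: "2 * cos t * (\<Sum>j=1..Suc N. cos (real j * t)) =
      (\<Sum>j=2..Suc (Suc N). cos (real j * t)) + (1 + (\<Sum>j=1..N. cos (real j * t)))" .
  have B: "(\<Sum>j=1..Suc (Suc N). cos (real j * t)) = cos t + (\<Sum>j=2..Suc (Suc N). cos (real j * t))"
    by (subst sum.atLeast_Suc_atMost) (auto simp: numeral_2_eq_2)
  have "poly (dirichlet_poly (Suc (Suc N))) (cos t) =
     2 * cos t * (1 + 2 * (\<Sum>j=1..Suc N. cos (real j * t))) - (1 + 2 * (\<Sum>j=1..N. cos (real j * t)))"
    using 3 by (simp add: mult.assoc)
  also have "\<dots> = 2 * cos t + 2 * (2 * cos t * (\<Sum>j=1..Suc N. cos (real j * t)))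
     - (1 + 2 * (\<Sum>j=1..N. cos (real j * t)))"
    by (simp only: distrib_left mult_1_right mult_ac)
  also have "\<dots> = 1 + 2 * (\<Sum>j=1..Suc (Suc N). cos (real j * t))"
    unfolding A B by (simp only: distrib_left)
  finally show ?case .
qed simp_all

text \<open>The differences sin((N + 3/2) t) - sin((N + 1/2) t) = 2 sin(t/2) cos((N + 1) t)
  telescope. The product form covers t = 0 as well.\<close>

lemma sin_half_times_dirichlet:
  "sin (t / 2) * poly (dirichlet_poly N) (cos t) = sin ((real N + 1 / 2) * t)"
proof -
  have "sin (t / 2) * (1 + 2 * (\<Sum>j=1..N. cos (real j * t))) = sin ((real N + 1 / 2) * t)"
  proof (induction N)
    case (Suc N)
    have eq1: "(real N + 3 / 2) * t = (real N + 1) * t + t / 2"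
      and eq2: "(real N + 1 / 2) * t = (real N + 1) * t - t / 2"
      by (simp_all add: field_simps)
    have "sin ((real N + 3 / 2) * t) = sin ((real N + 1 / 2) * t) + 2 * sin (t / 2) * cos ((real N + 1) * t)"
      unfolding eq1 eq2 sin_add sin_diff by simp
    then show ?case
      using Suc by (simp add: algebra_simps)
  qed simp
  then show ?thesis
    by (simp only: poly_dirichlet_poly_cos)
qed

text \<open>With x = cos t and 1 - x = 2 sin(t/2)^2 the left side becomes 2 sin((N + 1/2) t)^2. So
  the kernel is O(1 / sqrt(1 - x)), uniformly in N.\<close>

lemma dirichlet_poly_decay:
  assumes "\<bar>x\<bar> \<le> 1"
  shows "(poly (dirichlet_poly N) x)\<^sup>2 * (1 - x) \<le> 2"
proof -
  define t where "t = arccos x"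
  have x: "x = cos t"
    using assms by (simp add: t_def abs_le_iff)
  have "(poly (dirichlet_poly N) x)\<^sup>2 * (1 - x) = 2 * (sin (t / 2) * poly (dirichlet_poly N) (cos t))\<^sup>2"
    using cos_eq_one_minus_sin_half[of t] by (simp add: x power_mult_distrib)
  also have "\<dots> \<le> 2 * 1"
    unfolding sin_half_times_dirichlet using abs_square_le_1[of "sin ((real N + 1 / 2) * t)"] by simp
  finally show ?thesis by simp
qed

text \<open>The second hypothesis makes j^2 (1 - cos t) at most 1/2 for all j up to N, so each
  cosine in the kernel is at least 1/2.\<close>

lemma dirichlet_poly_ge:
  assumes "\<bar>x\<bar> \<le> 1" and "2 * (real N)\<^sup>2 * (1 - x) \<le> 1"
  shows "poly (dirichlet_poly N) x \<ge> real N"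
proof -
  define t where "t = arccos x"
  have x: "x = cos t"
    using assms by (simp add: t_def abs_le_iff)
  have "cos (real j * t) \<ge> 1 / 2" if "j \<in> {1..N}" for j
  proof -
    have "(real j)\<^sup>2 * (1 - cos t) \<le> (real N)\<^sup>2 * (1 - cos t)"
      using that by (intro mult_right_mono power_mono) auto
    then show ?thesis
      using cos_nat_mult_ge[of j t] assms(2) by (simp add: x)
  qed
  then have "(\<Sum>j=1..N. cos (real j * t)) \<ge> (\<Sum>j=1..N. 1 / 2)"
    by (intro sum_mono)
  then show ?thesis
    unfolding x poly_dirichlet_poly_cos by simp
qed

section \<open>Monic polynomials on short intervals\<close>

text \<open>Farther than l from z the integrand is at most 1, which contributes at most l; within
  distance l, each side of z contributes at most sqrt l * 2 sqrt l = 2 l. The bound is uniform in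
  the position of z.\<close>

lemma nn_integral_inverse_sqrt_dist_le:
  fixes a z l :: real
  assumes "l > 0"
  shows "(\<integral>\<^sup>+x. ennreal (sqrt l * \<bar>x - z\<bar> powr (-1/2)) * indicator {a..a + l} x \<partial>lborel) \<le> ennreal (5 * l)"
proof -
  have half: "(\<integral>\<^sup>+x. ennreal (x powr (-1/2)) * indicator {0..l} x \<partial>lborel) = ennreal (2 * sqrt l)"
    using nn_integral_has_integral_lebesgue'[OF _ has_integral_powr_from_0[of "-1/2" l]] assms
    by (simp add: powr_half_sqrt mult.commute)
  have right: "(\<integral>\<^sup>+x. ennreal (\<bar>x - z\<bar> powr (-1/2)) * indicator {z..z + l} x \<partial>lborel) = ennreal (2 * sqrt l)"
    by (subst nn_integral_real_affine[where c = 1 and t = z])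
       (auto simp: half[symmetric] indicator_def intro!: nn_integral_cong)
  have left: "(\<integral>\<^sup>+x. ennreal (\<bar>x - z\<bar> powr (-1/2)) * indicator {z - l..z} x \<partial>lborel) = ennreal (2 * sqrt l)"
    by (subst nn_integral_real_affine[where c = "-1" and t = z])
       (auto simp: half[symmetric] indicator_def intro!: nn_integral_cong)
  have "(\<integral>\<^sup>+x. ennreal (sqrt l * \<bar>x - z\<bar> powr (-1/2)) * indicator {a..a + l} x \<partial>lborel)
      \<le> (\<integral>\<^sup>+x. indicator {a..a + l} x
           + ennreal (sqrt l) * (ennreal (\<bar>x - z\<bar> powr (-1/2)) * indicator {z..z + l} x
           + ennreal (\<bar>x - z\<bar> powr (-1/2)) * indicator {z - l..z} x) \<partial>lborel)"
  proof (intro nn_integral_mono)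
    fix x :: real
    show "ennreal (sqrt l * \<bar>x - z\<bar> powr (-1/2)) * indicator {a..a + l} x
      \<le> indicator {a..a + l} x
           + ennreal (sqrt l) * (ennreal (\<bar>x - z\<bar> powr (-1/2)) * indicator {z..z + l} x
           + ennreal (\<bar>x - z\<bar> powr (-1/2)) * indicator {z - l..z} x)"
    proof (cases "\<bar>x - z\<bar> \<le> l")
      case True
      then have "x \<in> {z..z + l} \<or> x \<in> {z - l..z}"
        by auto
      then show ?thesis
        by (auto simp: indicator_def ennreal_mult' distrib_left intro!: add_increasing add_increasing2)
    next
      case False
      then have "\<bar>x - z\<bar> powr (-1/2) \<le> l powr (-1/2)"
        using assms by (intro powr_mono2') auto
      then have "sqrt l * \<bar>x - z\<bar> powr (-1/2) \<le> sqrt l * l powr (-1/2)"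
        using assms by (intro mult_left_mono) auto
      also have "\<dots> = 1"
        using assms by (simp add: powr_minus powr_half_sqrt)
      finally show ?thesis
        by (auto simp: indicator_def intro!: add_increasing2)
    qed
  qed
  also have "\<dots> = ennreal l + ennreal (sqrt l) * (ennreal (2 * sqrt l) + ennreal (2 * sqrt l))"
    using assms by (subst nn_integral_add; simp add: nn_integral_cmult nn_integral_add left right del: divide_minus_left)
  also have "\<dots> = ennreal (5 * l)"
    using assms by (simp flip: ennreal_plus ennreal_mult)
  finally show ?thesis .
qed

text \<open>Markov's inequality for the integrable function \<open>\<Sum>j. \<bar>x - z j\<bar> powr (-1/2)\<close>; where it is at
  most twice its mean bound, \<open>a \<le> exp (a - 1)\<close> turns it into a bound on the product.\<close>
lemma monic_product_large_on_half:
  fixes z :: "nat \<Rightarrow> real" and a l :: real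
  assumes "l > 0" and "k > 0"
  obtains S where "S \<in> sets borel" "S \<subseteq> {a..a + l}" "emeasure lborel S \<ge> ennreal (l / 2)"
    "\<And>x. x \<in> S \<Longrightarrow> \<bar>\<Prod>j<k. x - z j\<bar> \<ge> (exp (-18) * l) ^ k"
proof -
  define u where "u = (\<lambda>x. \<Sum>j<k. sqrt l * \<bar>x - z j\<bar> powr (-1/2))"
  \<comment> \<open>The integral of \<open>u\<close> over the interval is at most 5 l k, so the
    points with \<open>u x\<close> at least 10 k have measure at most l / 2.\<close>
  define B where "B = {x \<in> {a..a + l}. 1 \<le> ennreal (1 / (10 * k)) * ennreal (u x)}"
  \<comment> \<open>The zeros are removed because 0 powr (-1/2) = 0: at a zero its term in
    \<open>u\<close> vanishes instead of blowing up. They form a null set.\<close>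
  define S where "S = {a..a + l} - B - z ` {..<k}"
  have [measurable]: "u \<in> borel_measurable borel"
    unfolding u_def by measurable
  have u0: "u x \<ge> 0" for x
    using assms unfolding u_def by (intro sum_nonneg) auto
  have Bset [measurable]: "B \<in> sets borel"
    unfolding B_def by measurable
  have "emeasure lborel B \<le> ennreal (1 / (10 * k)) * (\<integral>\<^sup>+x. ennreal (u x) * indicator {a..a + l} x \<partial>lborel)"
    unfolding B_def by (rule nn_integral_Markov_inequality) auto
  also have "(\<integral>\<^sup>+x. ennreal (u x) * indicator {a..a + l} x \<partial>lborel)
      = (\<integral>\<^sup>+x. (\<Sum>j<k. ennreal (sqrt l * \<bar>x - z j\<bar> powr (-1/2)) * indicator {a..a + l} x) \<partial>lborel)"
    using assms unfolding u_def by (intro nn_integral_cong) (simp add: sum_distrib_right flip: sum_ennreal)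
  also have "\<dots> = (\<Sum>j<k. \<integral>\<^sup>+x. ennreal (sqrt l * \<bar>x - z j\<bar> powr (-1/2)) * indicator {a..a + l} x \<partial>lborel)"
    by (intro nn_integral_sum) auto
  also have "\<dots> \<le> (\<Sum>j<k. ennreal (5 * l))"
    by (intro sum_mono nn_integral_inverse_sqrt_dist_le assms)
  also have "\<dots> = ennreal (5 * l * k)"
    using assms by (simp add: ennreal_mult'' ennreal_of_nat_eq_real_of_nat mult.commute)
  also have "ennreal (1 / (10 * k)) * ennreal (5 * l * k) = ennreal (l / 2)"
    using assms by (simp flip: ennreal_mult add: field_simps)
  finally have B: "emeasure lborel B \<le> ennreal (l / 2)"
    by (simp add: mult_left_mono)
  have "ennreal (l / 2) = ennreal l - ennreal (l / 2)"
    using assms ennreal_minus[of "l / 2" l] by simp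
  also have "\<dots> \<le> emeasure lborel {a..a + l} - emeasure lborel B"
    using B assms by (intro ennreal_minus_mono) auto
  also have "\<dots> = emeasure lborel ({a..a + l} - B)"
    using B by (intro emeasure_Diff[symmetric]) (auto simp: B_def top_unique)
  also have "\<dots> = emeasure lborel S"
    unfolding S_def
    by (intro emeasure_Diff_null_set[symmetric] finite_imp_null_set_lborel) auto
  finally have S_large: "emeasure lborel S \<ge> ennreal (l / 2)" .
  show thesis
  proof (rule that[OF _ _ S_large])
    show "S \<in> sets borel"
      unfolding S_def by (intro sets.Diff Bset borel_closed finite_imp_closed[of "z ` {..<k}"]) auto
    show "S \<subseteq> {a..a + l}"
      by (auto simp: S_def)
    fix x assume x: "x \<in> S"
    define b where "b = (\<lambda>j. sqrt l * \<bar>x - z j\<bar> powr (-1/2))"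
    have "\<not> 1 \<le> ennreal (1 / (10 * k)) * ennreal (u x)"
      using x by (auto simp: S_def B_def)
    then have "u x \<le> 10 * k"
      using assms u0[of x] by (auto simp: field_simps simp flip: ennreal_mult)
    then have sum_b: "(\<Sum>j<k. b j) \<le> 10 * k"
      by (simp add: u_def b_def)
    \<comment> \<open>Since (b j)^2 times the distance equals l, the upper bound b j <= exp (b j -
      1) becomes a lower bound on the distance.\<close>
    have factor: "exp (2 - 2 * b j) * l \<le> \<bar>x - z j\<bar>" if "j < k" for j
    proof -
      define d where "d = \<bar>x - z j\<bar>"
      have d: "d > 0"
        using x that by (auto simp: S_def d_def)
      have b: "b j > 0" "(b j)\<^sup>2 * d = l"
        using d assms by (auto simp: b_def power_mult_distrib powr_half_sqrt powr_minus power_inverse simp flip: d_def)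
      have "b j \<le> exp (b j - 1)"
        using exp_ge_add_one_self[of "b j - 1"] by simp
      then have "(b j)\<^sup>2 \<le> (exp (b j - 1))\<^sup>2"
        using b by (intro power_mono) auto
      then have "l \<le> (exp (b j - 1))\<^sup>2 * d"
        using d b by (metis mult_right_mono less_imp_le)
      then have "exp (2 - 2 * b j) * l \<le> exp (2 - 2 * b j) * ((exp (b j - 1))\<^sup>2 * d)"
        by (intro mult_left_mono) auto
      also have "\<dots> = d"
        by (simp flip: exp_double mult.assoc exp_add)
      finally show ?thesis
        by (simp add: d_def)
    qed
    \<comment> \<open>The exponents 2 - 2 b j add up to at least 2 k - 20 k = -18 k.\<close>
    have "(exp (-18) * l) ^ k = exp (- 18 * k) * l ^ k"
      by (simp add: power_mult_distrib flip: exp_of_nat2_mult)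
    also have "\<dots> \<le> exp (\<Sum>j<k. 2 - 2 * b j) * l ^ k"
      using sum_b assms by (intro mult_right_mono) (auto simp: sum_subtractf simp flip: sum_distrib_left)
    also have "\<dots> = (\<Prod>j<k. exp (2 - 2 * b j) * l)"
      by (simp add: exp_sum prod.distrib)
    also have "\<dots> \<le> (\<Prod>j<k. \<bar>x - z j\<bar>)"
      using factor assms by (intro prod_mono) auto
    finally show "(exp (-18) * l) ^ k \<le> \<bar>\<Prod>j<k. x - z j\<bar>"
      by (simp add: abs_prod)
  qed
qed

section \<open>The Jacobi measure\<close>

text \<open>The substitution x = -1 + 2 u produces a Beta integral, which is finite and positive.
  Hence the Bochner integral in \<open>jacobi_const\<close> has its true value and not the default
  0.\<close>

lemma jacobi_const_pos_and_total:
  assumes "\<alpha> > -1" "\<beta> > -1"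
  shows jacobi_const_pos: "jacobi_const \<alpha> \<beta> > 0"
    and nn_integral_jacobi_weight:
      "(\<integral>\<^sup>+x. ennreal (jacobi_weight \<alpha> \<beta> x) * indicator {-1..1} x \<partial>lborel) = 1"
proof -
  define W where "W = (\<lambda>x::real. (1 - x) powr \<alpha> * (1 + x) powr \<beta>)"
  define b where "b = 2 * 2 powr (\<alpha> + \<beta>) * Beta (\<beta> + 1) (\<alpha> + 1)"
  have Beta: "Beta (\<beta> + 1) (\<alpha> + 1) > 0"
    using assms by (auto simp: Beta_def)
  then have b: "b > 0"
    by (simp add: b_def)
  have [measurable]: "W \<in> borel_measurable borel"
    unfolding W_def by measurable
  have "(\<integral>\<^sup>+x. ennreal (W x) * indicator {-1..1} x \<partial>lborel)
      = 2 * (\<integral>\<^sup>+x. ennreal (W (-1 + 2 * x)) * indicator {-1..1} (-1 + 2 * x) \<partial>lborel)"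
    by (subst nn_integral_real_affine[where c = 2 and t = "-1"]) auto
  also have "(\<integral>\<^sup>+x. ennreal (W (-1 + 2 * x)) * indicator {-1..1} (-1 + 2 * x) \<partial>lborel)
     = (\<integral>\<^sup>+x. ennreal (2 powr (\<alpha> + \<beta>)) * (ennreal (x powr \<beta> * (1 - x) powr \<alpha>) * indicator {0..1} x) \<partial>lborel)"
  proof (intro nn_integral_cong)
    fix x :: real
    have "W (-1 + 2 * x) = 2 powr (\<alpha> + \<beta>) * (x powr \<beta> * (1 - x) powr \<alpha>)" if "x \<in> {0..1}"
    proof -
      have "1 - (-1 + 2 * x) = 2 * (1 - x)" "1 + (-1 + 2 * x) = 2 * x"
        by auto
      moreover have "(2 * (1 - x)) powr \<alpha> = 2 powr \<alpha> * (1 - x) powr \<alpha>"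
        and "(2 * x) powr \<beta> = 2 powr \<beta> * x powr \<beta>"
        using that by (subst powr_mult; simp)+
      ultimately show ?thesis
        by (simp only: W_def powr_add mult_ac)
    qed
    then show "ennreal (W (-1 + 2 * x)) * indicator {-1..1} (-1 + 2 * x)
        = ennreal (2 powr (\<alpha> + \<beta>)) * (ennreal (x powr \<beta> * (1 - x) powr \<alpha>) * indicator {0..1} x)"
      by (auto simp: indicator_def ennreal_mult)
  qed
  also have "\<dots> = ennreal (2 powr (\<alpha> + \<beta>)) * ennreal (Beta (\<beta> + 1) (\<alpha> + 1))"
    using nn_integral_has_integral_lebesgue'[OF _ has_integral_Beta_real[of "\<beta> + 1" "\<alpha> + 1"]] assms
    by (simp add: nn_integral_cmult)
  also have "2 * \<dots> = ennreal b"
    using Beta by (simp add: b_def ennreal_mult mult.assoc)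
  finally have nn: "(\<integral>\<^sup>+x. ennreal (W x) * indicator {-1..1} x \<partial>lborel) = ennreal b" .
  have "set_lebesgue_integral lborel {-1..1} W = b"
    unfolding set_lebesgue_integral_def
  proof (subst integral_eq_nn_integral)
    show "AE x in lborel. 0 \<le> indicator {-1..1} x *\<^sub>R W x"
      by (auto simp: W_def)
    have "(\<integral>\<^sup>+x. ennreal (indicator {-1..1} x *\<^sub>R W x) \<partial>lborel) = ennreal b"
      unfolding nn[symmetric] by (intro nn_integral_cong) (auto simp: indicator_def)
    then show "enn2real (\<integral>\<^sup>+x. ennreal (indicator {-1..1} x *\<^sub>R W x) \<partial>lborel) = b"
      using b by simp
  qed auto
  then have c: "jacobi_const \<alpha> \<beta> = inverse b"
    by (simp add: jacobi_const_def W_def)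
  show "jacobi_const \<alpha> \<beta> > 0"
    using b by (simp add: c)
  have "(\<integral>\<^sup>+x. ennreal (jacobi_weight \<alpha> \<beta> x) * indicator {-1..1} x \<partial>lborel)
      = (\<integral>\<^sup>+x. ennreal (inverse b) * (ennreal (W x) * indicator {-1..1} x) \<partial>lborel)"
    using b by (intro nn_integral_cong) (simp add: jacobi_weight_def c W_def ennreal_mult flip: mult.assoc)
  also have "\<dots> = 1"
    using b by (simp add: nn_integral_cmult nn flip: ennreal_mult)
  finally show "(\<integral>\<^sup>+x. ennreal (jacobi_weight \<alpha> \<beta> x) * indicator {-1..1} x \<partial>lborel) = 1" .
qed

lemma jacobi_weight_measurable [measurable]: "jacobi_weight \<alpha> \<beta> \<in> borel_measurable borel"
  unfolding jacobi_weight_def by measurable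

lemma space_jacobi_measure [simp]: "space (jacobi_measure \<alpha> \<beta>) = {-1..1}"
  by (simp add: jacobi_measure_def space_restrict_space)

lemma sets_jacobi_measure: "sets (jacobi_measure \<alpha> \<beta>) = sets (restrict_space borel {-1..1})"
  by (simp add: jacobi_measure_def cong: sets_restrict_space_cong)

lemma borel_measurable_jacobi_measure:
  "f \<in> borel_measurable borel \<Longrightarrow> f \<in> borel_measurable (jacobi_measure \<alpha> \<beta>)"
  using measurable_cong_sets[OF sets_jacobi_measure refl, of _ _ borel] measurable_restrict_space1 by blast

lemma in_sets_jacobi_measure:
  "E \<in> sets borel \<Longrightarrow> E \<subseteq> {-1..1} \<Longrightarrow> E \<in> sets (jacobi_measure \<alpha> \<beta>)"
  by (auto simp: sets_jacobi_measure sets_restrict_space_iff)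

lemma emeasure_jacobi_measure:
  assumes "E \<in> sets borel" "E \<subseteq> {-1..1}"
  shows "emeasure (jacobi_measure \<alpha> \<beta>) E = (\<integral>\<^sup>+x. ennreal (jacobi_weight \<alpha> \<beta> x) * indicator E x \<partial>lborel)"
proof -
  have "E \<in> sets (restrict_space lborel {-1..1})"
    using assms by (auto simp: sets_restrict_space_iff)
  then have "emeasure (jacobi_measure \<alpha> \<beta>) E
      = (\<integral>\<^sup>+x. ennreal (jacobi_weight \<alpha> \<beta> x) * indicator E x \<partial>restrict_space lborel {-1..1})"
    unfolding jacobi_measure_def by (intro emeasure_density) (auto intro!: measurable_restrict_space1)
  also have "\<dots> = (\<integral>\<^sup>+x. ennreal (jacobi_weight \<alpha> \<beta> x) * indicator E x * indicator {-1..1} x \<partial>lborel)"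
    by (subst nn_integral_restrict_space) auto
  also have "\<dots> = (\<integral>\<^sup>+x. ennreal (jacobi_weight \<alpha> \<beta> x) * indicator E x \<partial>lborel)"
    using assms by (intro nn_integral_cong) (auto simp: indicator_def)
  finally show ?thesis .
qed

lemma prob_space_jacobi_measure:
  assumes "\<alpha> > -1" "\<beta> > -1"
  shows "prob_space (jacobi_measure \<alpha> \<beta>)"
  using nn_integral_jacobi_weight[OF assms] by (intro prob_spaceI) (simp add: emeasure_jacobi_measure)

lemma emeasure_jacobi_measure_singleton:
  "emeasure (jacobi_measure \<alpha> \<beta>) {x \<in> space (jacobi_measure \<alpha> \<beta>). x = y} = 0"
proof -
  have "{x \<in> space (jacobi_measure \<alpha> \<beta>). x = y} = {-1..1} \<inter> {y}"
    by auto
  moreover have "emeasure (jacobi_measure \<alpha> \<beta>) ({-1..1} \<inter> {y}) = 0"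
    by (subst emeasure_jacobi_measure) (auto intro!: nn_integral_null_set finite_imp_null_set_lborel)
  ultimately show ?thesis
    by simp
qed

text \<open>The reflection x -> \<sigma> x lets both orders of \<alpha> and \<beta> be treated
  together: \<open>1 - \<sigma> * x\<close> is the distance from the endpoint with the larger
  exponent.\<close>

lemma jacobi_weight_endpoint:
  obtains \<sigma> :: real where "\<sigma> = 1 \<or> \<sigma> = -1"
    "\<And>x. jacobi_weight \<alpha> \<beta> x
       = jacobi_const \<alpha> \<beta> * (1 - \<sigma> * x) powr (max \<alpha> \<beta>) * (1 + \<sigma> * x) powr (min \<alpha> \<beta>)"
proof (cases "\<alpha> \<ge> \<beta>")
  case True
  then show ?thesis
    by (intro that[of 1]) (auto simp: jacobi_weight_def max_def min_def)
next
  case False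
  then show ?thesis
    by (intro that[of "-1"]) (auto simp: jacobi_weight_def max_def min_def)
qed

text \<open>For negative \<delta> the power is largest at u = 1, with value 1, which is at most 2 *
  2 powr \<delta> because \<delta> > -1. This factor 2 becomes the 2 in the failure
  probability.\<close>

lemma powr_two_minus_le:
  fixes u \<delta> :: real
  assumes "\<delta> > -1" "0 \<le> u" "u \<le> 1"
  shows "(2 - u) powr \<delta> \<le> 2 * 2 powr \<delta>"
proof (cases "\<delta> \<ge> 0")
  case True
  then have "(2 - u) powr \<delta> \<le> 2 powr \<delta>"
    using assms by (intro powr_mono2) auto
  then show ?thesis
    using powr_ge_zero[of 2 \<delta>] by linarith
next
  case False
  then have "(2 - u) powr \<delta> \<le> 1 powr \<delta>"
    using assms by (intro powr_mono2') auto
  also have "1 powr \<delta> \<le> 2 powr (1 + \<delta>)"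
    using assms by (simp add: ge_one_powr_ge_zero)
  finally show ?thesis
    by (simp add: powr_add)
qed

text \<open>In the coordinate u = 1 - \<sigma> x the set lies in [0, d]. The factor from the far
  endpoint is bounded by \<open>powr_two_minus_le\<close>, and integrating u powr \<gamma> gives the
  power of d. For the maximal \<gamma> and minimal \<delta> the constant in parentheses is
  \<open>cbar\<close>.\<close>

lemma measure_jacobi_tail_le:
  fixes \<alpha> \<beta> \<sigma> d :: real
  assumes "\<alpha> > -1" "\<beta> > -1" "\<sigma> = 1 \<or> \<sigma> = -1"
    and w: "\<And>x. jacobi_weight \<alpha> \<beta> x
       = jacobi_const \<alpha> \<beta> * (1 - \<sigma> * x) powr \<gamma> * (1 + \<sigma> * x) powr \<delta>"
    and "\<gamma> > -1" "\<delta> > -1" "0 < d" "d \<le> 1"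
  shows "measure (jacobi_measure \<alpha> \<beta>) {x \<in> {-1..1}. \<sigma> * x > 1 - d}
     \<le> 2 * (jacobi_const \<alpha> \<beta> * 2 powr \<delta> / (1 + \<gamma>)) * d powr (1 + \<gamma>)"
proof -
  define E where "E = {x \<in> {-1..1}. \<sigma> * x > 1 - d}"
  define c where "c = jacobi_const \<alpha> \<beta>"
  have c: "c > 0"
    using assms unfolding c_def by (intro jacobi_const_pos)
  have [measurable]: "E \<in> sets borel"
    unfolding E_def by measurable
  have ss: "\<sigma> * \<sigma> = 1" "\<bar>\<sigma>\<bar> = 1" "\<sigma> \<noteq> 0"
    using assms by auto
  have "emeasure (jacobi_measure \<alpha> \<beta>) E = (\<integral>\<^sup>+x. ennreal (jacobi_weight \<alpha> \<beta> x) * indicator E x \<partial>lborel)"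
    by (intro emeasure_jacobi_measure) (auto simp: E_def)
  also have "\<dots> = (\<integral>\<^sup>+u. ennreal (jacobi_weight \<alpha> \<beta> (\<sigma> + (-\<sigma>) * u)) * indicator E (\<sigma> + (-\<sigma>) * u) \<partial>lborel)"
    using ss by (subst nn_integral_real_affine[where c = "-\<sigma>" and t = \<sigma>]) auto
  also have "\<dots> \<le> (\<integral>\<^sup>+u. ennreal (c * (2 * 2 powr \<delta>)) * (ennreal (u powr \<gamma>) * indicator {0..d} u) \<partial>lborel)"
  proof (intro nn_integral_mono)
    fix u :: real
    have s: "\<sigma> * (\<sigma> + (-\<sigma>) * u) = 1 - u"
      using ss by (simp add: algebra_simps flip: mult.assoc)
    show "ennreal (jacobi_weight \<alpha> \<beta> (\<sigma> + (-\<sigma>) * u)) * indicator E (\<sigma> + (-\<sigma>) * u)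
       \<le> ennreal (c * (2 * 2 powr \<delta>)) * (ennreal (u powr \<gamma>) * indicator {0..d} u)"
    proof (cases "\<sigma> + (-\<sigma>) * u \<in> E")
      case True
      then have "u \<in> {0..d}"
        using s assms(3) by (auto simp: E_def)
      moreover from this have "c * u powr \<gamma> * (2 - u) powr \<delta> \<le> c * u powr \<gamma> * (2 * 2 powr \<delta>)"
        using assms c by (intro mult_left_mono powr_two_minus_le) auto
      moreover have "jacobi_weight \<alpha> \<beta> (\<sigma> + (-\<sigma>) * u) = c * u powr \<gamma> * (2 - u) powr \<delta>"
        unfolding w s by (simp add: c_def)
      ultimately show ?thesis
        using c by (auto simp: indicator_def mult_ac simp flip: ennreal_mult intro!: ennreal_leI)
    qed simp
  qed
  also have "\<dots> = ennreal (c * (2 * 2 powr \<delta>)) * ennreal (d powr (\<gamma> + 1) / (\<gamma> + 1))"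
    using nn_integral_has_integral_lebesgue'[OF _ has_integral_powr_from_0[of \<gamma> d]] assms
    by (simp add: nn_integral_cmult)
  also have "\<dots> = ennreal (2 * (c * 2 powr \<delta> / (1 + \<gamma>)) * d powr (1 + \<gamma>))"
    using assms c by (simp add: add_ac flip: ennreal_mult)
  finally show ?thesis
    unfolding E_def[symmetric] c_def[symmetric] measure_def using assms c
    by (intro enn2real_leI) auto
qed

text \<open>The power is smallest at d / 2 if \<gamma> >= 0 and at d otherwise; the minimum covers
  both signs.\<close>

lemma powr_half_interval_ge:
  fixes d t \<gamma> :: real
  assumes "0 < d" "d / 2 \<le> t" "t \<le> d"
  shows "t powr \<gamma> \<ge> min 1 (2 powr (-\<gamma>)) * d powr \<gamma>"
proof (cases "\<gamma> \<ge> 0")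
  case True
  have "min 1 (2 powr (-\<gamma>)) * d powr \<gamma> \<le> 2 powr (-\<gamma>) * d powr \<gamma>"
    by (intro mult_right_mono) auto
  also have "\<dots> = (d / 2) powr \<gamma>"
    using assms by (simp add: powr_divide powr_minus field_simps)
  also have "\<dots> \<le> t powr \<gamma>"
    using assms True by (intro powr_mono2) auto
  finally show ?thesis .
next
  case False
  have "min 1 (2 powr (-\<gamma>)) * d powr \<gamma> \<le> 1 * d powr \<gamma>"
    by (intro mult_right_mono) auto
  also have "\<dots> \<le> t powr \<gamma>"
    using assms False by (simp add: powr_mono2')
  finally show ?thesis .
qed

text \<open>For y in S, 1 - y lies between d / 2 and d, and 1 + y between 1 and 2. So the density is
  at least a constant times d powr \<gamma>, which is multiplied by the Lebesgue measure of
  S.\<close>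

lemma measure_jacobi_near_endpoint_ge:
  fixes \<alpha> \<beta> \<sigma> d :: real
  assumes "\<alpha> > -1" "\<beta> > -1" "\<sigma> = 1 \<or> \<sigma> = -1"
    and w: "\<And>x. jacobi_weight \<alpha> \<beta> x
       = jacobi_const \<alpha> \<beta> * (1 - \<sigma> * x) powr \<gamma> * (1 + \<sigma> * x) powr \<delta>"
    and "0 < d" "d \<le> 1" and [measurable]: "S \<in> sets borel" and S: "S \<subseteq> {1 - d..1 - d / 2}"
    and lam: "emeasure lborel S \<ge> ennreal l" "l \<ge> 0"
  shows "measure (jacobi_measure \<alpha> \<beta>) {x \<in> {-1..1}. \<sigma> * x \<in> S}
     \<ge> jacobi_const \<alpha> \<beta> * min 1 (2 powr (-\<gamma>)) * min 1 (2 powr \<delta>) * d powr \<gamma> * l"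
proof -
  interpret prob_space "jacobi_measure \<alpha> \<beta>"
    using assms by (intro prob_space_jacobi_measure)
  define E where "E = {x \<in> {-1..1}. \<sigma> * x \<in> S}"
  define K where "K = jacobi_const \<alpha> \<beta> * min 1 (2 powr (-\<gamma>)) * min 1 (2 powr \<delta>) * d powr \<gamma>"
  have c: "jacobi_const \<alpha> \<beta> > 0"
    using assms by (intro jacobi_const_pos)
  then have K: "K \<ge> 0"
    by (simp add: K_def)
  have [measurable]: "E \<in> sets borel"
    unfolding E_def by measurable
  have ss: "\<sigma> * \<sigma> = 1" "\<bar>\<sigma>\<bar> = 1" "\<sigma> \<noteq> 0"
    using assms by auto
  have "ennreal (K * l) \<le> ennreal K * emeasure lborel S"
    using K lam by (simp add: ennreal_mult mult_left_mono)
  also have "\<dots> = (\<integral>\<^sup>+y. ennreal K * indicator S y \<partial>lborel)"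
    by (simp add: nn_integral_cmult)
  also have "\<dots> \<le> (\<integral>\<^sup>+y. ennreal (jacobi_weight \<alpha> \<beta> (0 + \<sigma> * y)) * indicator E (0 + \<sigma> * y) \<partial>lborel)"
  proof (intro nn_integral_mono)
    fix y :: real
    have s: "\<sigma> * (\<sigma> * y) = y"
      using ss by (simp flip: mult.assoc)
    show "ennreal K * indicator S y \<le> ennreal (jacobi_weight \<alpha> \<beta> (0 + \<sigma> * y)) * indicator E (0 + \<sigma> * y)"
    proof (cases "y \<in> S")
      case True
      then have y: "1 - d \<le> y" "y \<le> 1 - d / 2"
        using S by auto
      then have "\<sigma> * y \<in> E"
        using True s assms by (auto simp: E_def)
      moreover have "K \<le> jacobi_const \<alpha> \<beta> * (1 - y) powr \<gamma> * (1 + y) powr \<delta>"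
      proof -
        have "min 1 (2 powr \<delta>) \<le> (1 + y) powr \<delta>"
        proof (cases "\<delta> \<ge> 0")
          case True
          then have "1 \<le> (1 + y) powr \<delta>"
            using y assms(6) by (intro ge_one_powr_ge_zero) auto
          then show ?thesis
            by simp
        next
          case False
          then have "2 powr \<delta> \<le> (1 + y) powr \<delta>"
            using y assms(5,6) by (intro powr_mono2') auto
          then show ?thesis
            by simp
        qed
        moreover have "min 1 (2 powr (-\<gamma>)) * d powr \<gamma> \<le> (1 - y) powr \<gamma>"
          using y assms by (intro powr_half_interval_ge) auto
        ultimately have "jacobi_const \<alpha> \<beta> * (min 1 (2 powr (-\<gamma>)) * d powr \<gamma>) * min 1 (2 powr \<delta>)
            \<le> jacobi_const \<alpha> \<beta> * (1 - y) powr \<gamma> * (1 + y) powr \<delta>"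
          using c by (intro mult_mono) auto
        then show ?thesis
          by (simp add: K_def mult_ac)
      qed
      ultimately show ?thesis
        using True unfolding w by (simp add: s ennreal_leI)
    qed simp
  qed
  also have "\<dots> = (\<integral>\<^sup>+x. ennreal (jacobi_weight \<alpha> \<beta> x) * indicator E x \<partial>lborel)"
    using ss by (subst nn_integral_real_affine[where c = \<sigma> and t = 0]) auto
  also have "\<dots> = emeasure (jacobi_measure \<alpha> \<beta>) E"
    by (intro emeasure_jacobi_measure[symmetric]) (auto simp: E_def)
  finally show ?thesis
    by (simp add: emeasure_eq_measure E_def K_def)
qed

section \<open>Least squares projection of polynomials\<close>

lemma emp_norm_eq_0_iff:
  assumes "n > 0"
  shows "emp_norm n x f = 0 \<longleftrightarrow> (\<forall>i\<in>{1..n}. f (x i) = 0)"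
  using assms by (simp add: emp_norm_def sum_nonneg_eq_0_iff)

lemma poly_eq_if_agree_on_sample:
  fixes p q :: "real poly"
  assumes "inj_on x {1..n}" "m < n" "degree p \<le> m" "degree q \<le> m"
    and "\<And>i. i \<in> {1..n} \<Longrightarrow> poly p (x i) = poly q (x i)"
  shows "p = q"
proof (rule poly_eqI_degree[where A = "x ` {1..n}"])
  show "card (x ` {1..n}) > degree p" "card (x ` {1..n}) > degree q"
    using assms by (simp_all add: card_image)
qed (use assms in auto)

text \<open>More than m distinct points determine a polynomial of degree at most m, so p alone has
  residual zero and \<open>arg_min\<close> has no choice left.\<close>

lemma lsq_proj_poly:
  assumes "inj_on x {1..n}" "m < n" "degree p \<le> m"
  shows "lsq_proj m n x (poly p) = p"
  unfolding lsq_proj_def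
proof (rule arg_minI)
  have zero: "emp_norm n x (\<lambda>t. poly p t - poly p t) = 0"
    using assms by (simp add: emp_norm_eq_0_iff)
  have nonneg: "emp_norm n x f \<ge> 0" for f
    by (simp add: emp_norm_def sum_nonneg)
  show "degree p \<le> m"
    by fact
  show "\<not> emp_norm n x (\<lambda>t. poly q t - poly p t) < emp_norm n x (\<lambda>t. poly p t - poly p t)" for q
    using zero nonneg[of "\<lambda>t. poly q t - poly p t"] by linarith
  fix q
  assume "degree q \<le> m" and *: "\<forall>r. degree r \<le> m \<longrightarrow>
    \<not> emp_norm n x (\<lambda>t. poly r t - poly p t) < emp_norm n x (\<lambda>t. poly q t - poly p t)"
  have "emp_norm n x (\<lambda>t. poly q t - poly p t) = 0"
    using *[rule_format, OF \<open>degree p \<le> m\<close>] zero nonneg[of "\<lambda>t. poly q t - poly p t"] by linarith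
  then show "q = p"
    using assms \<open>degree q \<le> m\<close> by (intro poly_eq_if_agree_on_sample[of x n m]) (auto simp: emp_norm_eq_0_iff)
qed

lemma emp_norm_poly_pos:
  assumes "inj_on x {1..n}" "m < n" "degree p \<le> m" "p \<noteq> 0"
  shows "emp_norm n x (poly p) > 0"
proof -
  have "emp_norm n x (poly p) \<noteq> 0"
  proof
    assume "emp_norm n x (poly p) = 0"
    then have "p = 0"
      using assms by (intro poly_eq_if_agree_on_sample[of x n m]) (auto simp: emp_norm_eq_0_iff)
    then show False
      using assms by simp
  qed
  moreover have "emp_norm n x (poly p) \<ge> 0"
    by (simp add: emp_norm_def sum_nonneg)
  ultimately show ?thesis
    by linarith
qed

text \<open>The polynomial, being its own projection, serves as the test function in the
  supremum.\<close>

lemma cond_number_ge_poly: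
  assumes "inj_on x {1..n}" "m < n" "degree p \<le> m" "p \<noteq> 0"
  shows "cond_number \<rho> m n x \<ge> ereal (L2_norm \<rho> (poly p) / emp_norm n x (poly p))"
  unfolding cond_number_def using assms emp_norm_poly_pos[OF assms]
  by (intro SUP_upper2[of "poly p"]) (auto simp: lsq_proj_poly)

lemma emp_norm_le:
  assumes "\<And>i. i \<in> {1..n} \<Longrightarrow> \<bar>f (x i)\<bar> \<le> b" "b \<ge> 0"
  shows "emp_norm n x f \<le> b"
proof (cases "n = 0")
  case False
  have "(\<Sum>i\<in>{1..n}. \<bar>f (x i)\<bar>\<^sup>2) \<le> (\<Sum>i\<in>{1..n}. b\<^sup>2)"
    using assms by (intro sum_mono power_mono) auto
  then have "1 / real n * (\<Sum>i\<in>{1..n}. \<bar>f (x i)\<bar>\<^sup>2) \<le> b\<^sup>2"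
    using False by (simp add: field_simps)
  then show ?thesis
    unfolding emp_norm_def using assms(2) by (intro real_le_lsqrt) (auto intro!: mult_nonneg_nonneg sum_nonneg)
qed (use assms in \<open>simp add: emp_norm_def\<close>)

section \<open>Random samples\<close>

text \<open>By Fubini: with all other coordinates fixed, x i = x j asks coordinate i to hit one
  given point, which has probability 0.\<close>

lemma AE_PiM_coordinates_distinct:
  fixes \<rho> :: "real measure"
  assumes "prob_space \<rho>" and [measurable]: "(\<lambda>x. x) \<in> borel_measurable \<rho>"
    and no_atoms: "\<And>y. emeasure \<rho> {x \<in> space \<rho>. x = y} = 0"
    and "finite I" "i \<in> I" "j \<in> I" "i \<noteq> j"
  shows "AE x in PiM I (\<lambda>_. \<rho>). x i \<noteq> x j"
proof -
  interpret prob_space \<rho> by fact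
  interpret product_sigma_finite "\<lambda>_. \<rho>" ..
  define J where "J = I - {i}"
  have I: "I = insert i J" "finite J" "i \<notin> J" "j \<in> J"
    using assms by (auto simp: J_def)
  have [measurable]: "(\<lambda>x. x k) \<in> borel_measurable (PiM I (\<lambda>_. \<rho>))" if "k \<in> I" for k
    using measurable_compose[OF measurable_component_singleton[OF that] assms(2)] .
  note meas = this[OF \<open>i \<in> I\<close>] this[OF \<open>j \<in> I\<close>]
  let ?D = "{x \<in> space (PiM I (\<lambda>_. \<rho>)). x i = x j}"
  have D: "?D \<in> sets (PiM I (\<lambda>_. \<rho>))"
    using meas by measurable
  have "emeasure (PiM I (\<lambda>_. \<rho>)) ?D = (\<integral>\<^sup>+x. indicator ?D x \<partial>PiM I (\<lambda>_. \<rho>))"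
    using D by simp
  also have "\<dots> = (\<integral>\<^sup>+x. (\<integral>\<^sup>+y. indicator ?D (x(i := y)) \<partial>\<rho>) \<partial>PiM J (\<lambda>_. \<rho>))"
    using D I unfolding I(1) by (intro product_nn_integral_insert) auto
  also have "\<dots> = (\<integral>\<^sup>+x. 0 \<partial>PiM J (\<lambda>_. \<rho>))"
  proof (intro nn_integral_cong)
    fix x assume x: "x \<in> space (PiM J (\<lambda>_. \<rho>))"
    have "(\<integral>\<^sup>+y. indicator ?D (x(i := y)) \<partial>\<rho>) = (\<integral>\<^sup>+y. indicator {y \<in> space \<rho>. y = x j} y \<partial>\<rho>)"
      using x I assms(7) by (intro nn_integral_cong) (auto simp: indicator_def space_PiM PiE_iff extensional_def)
    also have "\<dots> = emeasure \<rho> {y \<in> space \<rho>. y = x j}"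
      by (rule nn_integral_indicator) measurable
    also have "\<dots> = 0"
      by (rule no_atoms)
    finally show "(\<integral>\<^sup>+y. indicator ?D (x(i := y)) \<partial>\<rho>) = 0" .
  qed
  finally show ?thesis
    using D by (intro AE_I[where N = ?D]) auto
qed

text \<open>Markov's inequality for the number of samples in E, whose mean is
  \<open>card I * measure \<rho> E\<close>; more than k means at least k + 1, hence the denominator.
  Discarding the null event of coinciding samples costs no probability.\<close>

lemma sample_event:
  fixes \<rho> :: "real measure"
  assumes "prob_space \<rho>" and id_meas: "(\<lambda>x. x) \<in> borel_measurable \<rho>"
    and no_atoms: "\<And>y. emeasure \<rho> {x \<in> space \<rho>. x = y} = 0"
    and E [measurable]: "E \<in> sets \<rho>" and "finite I"
  obtains A where "A \<in> sets (PiM I (\<lambda>_. \<rho>))"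
    "measure (PiM I (\<lambda>_. \<rho>)) A \<ge> 1 - card I * measure \<rho> E / (real k + 1)"
    "\<And>x. x \<in> A \<Longrightarrow> x \<in> I \<rightarrow> space \<rho> \<and> inj_on x I \<and> card {i \<in> I. x i \<in> E} \<le> k"
proof -
  interpret R: prob_space \<rho> by fact
  let ?P = "PiM I (\<lambda>_. \<rho>)"
  interpret P: prob_space ?P
    by (intro prob_space_PiM R.prob_space_axioms)
  define u where "u = (\<lambda>x. \<Sum>i\<in>I. indicator E (x i) :: ennreal)"
  define B where "B = {x \<in> space ?P. 1 \<le> ennreal (1 / (real k + 1)) * u x}"
  define G where "G = {x \<in> space ?P. \<forall>i\<in>I. \<forall>j\<in>I. i \<noteq> j \<longrightarrow> x i \<noteq> x j}"
  have [measurable]: "(\<lambda>x. x i) \<in> measurable ?P \<rho>" if "i \<in> I" for i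
    using that by measurable
  have coord: "(\<lambda>x. x i) \<in> borel_measurable ?P" if "i \<in> I" for i
    using measurable_compose[OF measurable_component_singleton[OF that] id_meas] .
  have u_meas: "u \<in> borel_measurable ?P"
    unfolding u_def by measurable
  have B_sets: "B \<in> sets ?P"
    unfolding B_def using u_meas by measurable
  have G_sets: "G \<in> sets ?P"
  proof -
    have "{x \<in> space ?P. i \<noteq> j \<longrightarrow> x i \<noteq> x j} \<in> sets ?P" if "i \<in> I" "j \<in> I" for i j
      using borel_measurable_neq[OF coord[OF that(1)] coord[OF that(2)]] by (cases "i = j") auto
    then show ?thesis
      unfolding G_def using \<open>finite I\<close> by (cases "I = {}") (auto intro!: sets.sets_Collect_finite_All')
  qed
  have "AE x in ?P. \<forall>i\<in>I. \<forall>j\<in>I. i \<noteq> j \<longrightarrow> x i \<noteq> x j"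
    using assms by (intro AE_finite_allI AE_impI AE_PiM_coordinates_distinct) auto
  then have AE_G: "AE x in ?P. x \<in> G"
    by (rule AE_mp) (auto simp: G_def)
  have "emeasure ?P B \<le> ennreal (1 / (real k + 1)) * (\<integral>\<^sup>+x. u x * indicator (space ?P) x \<partial>?P)"
    unfolding B_def using u_meas by (intro nn_integral_Markov_inequality) auto
  also have "(\<integral>\<^sup>+x. u x * indicator (space ?P) x \<partial>?P) = (\<integral>\<^sup>+x. u x \<partial>?P)"
    by (intro nn_integral_cong) auto
  also have "\<dots> = (\<Sum>i\<in>I. \<integral>\<^sup>+x. indicator E (x i) \<partial>?P)"
    unfolding u_def by (intro nn_integral_sum) measurable
  also have "\<dots> = (\<Sum>i\<in>I. emeasure \<rho> E)"
  proof (intro sum.cong refl)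
    fix i assume i: "i \<in> I"
    have "(\<integral>\<^sup>+x. indicator E (x i) \<partial>?P) = (\<integral>\<^sup>+y. indicator E y \<partial>distr ?P \<rho> (\<lambda>x. x i))"
      using i by (intro nn_integral_distr[symmetric]) auto
    then show "(\<integral>\<^sup>+x. indicator E (x i) \<partial>?P) = emeasure \<rho> E"
      using distr_PiM_component[OF assms(1) i] by simp
  qed
  also have "\<dots> = ennreal (card I * measure \<rho> E)"
    by (simp add: R.emeasure_eq_measure ennreal_mult ennreal_of_nat_eq_real_of_nat)
  also have "ennreal (1 / (real k + 1)) * ennreal (card I * measure \<rho> E) = ennreal (card I * measure \<rho> E / (real k + 1))"
    by (simp flip: ennreal_mult)
  finally have B: "measure ?P B \<le> card I * measure \<rho> E / (real k + 1)"
    by (simp add: P.emeasure_eq_measure)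
  have "1 - measure ?P B = measure ?P (space ?P - B)"
    using B_sets by (simp add: P.prob_compl)
  also have "\<dots> = measure ?P (G - B)"
    using AE_G B_sets G_sets by (intro P.finite_measure_eq_AE) auto
  finally have A: "measure ?P (G - B) \<ge> 1 - card I * measure \<rho> E / (real k + 1)"
    using B by simp
  show thesis
  proof (rule that[OF _ A])
    show "G - B \<in> sets ?P"
      using G_sets B_sets by auto
    fix x assume x: "x \<in> G - B"
    have "u x = of_nat (card {i \<in> I. x i \<in> E})"
      using \<open>finite I\<close> by (simp add: u_def indicator_def sum.If_cases Int_def)
    moreover have "\<not> 1 \<le> ennreal (1 / (real k + 1)) * u x"
      using x by (auto simp: B_def G_def)
    moreover have "ennreal (1 / (real k + 1)) * of_nat c = ennreal (real c / (real k + 1))" for c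
      by (simp add: ennreal_of_nat_eq_real_of_nat flip: ennreal_mult)
    ultimately have "\<not> 1 \<le> real (card {i \<in> I. x i \<in> E}) / (real k + 1)"
      by simp
    then have "card {i \<in> I. x i \<in> E} \<le> k"
      by (simp add: field_simps)
    then show "x \<in> I \<rightarrow> space \<rho> \<and> inj_on x I \<and> card {i \<in> I. x i \<in> E} \<le> k"
      using x by (auto simp: G_def space_PiM inj_on_def)
  qed
qed

section \<open>Ill-conditioning caused by a gap at an endpoint\<close>

text \<open>The bound M guarantees integrability; the Bochner integral of a non-integrable square
  would be 0.\<close>

lemma L2_norm_ge_on_set:
  assumes "prob_space \<rho>" "f \<in> borel_measurable \<rho>" "\<And>x. x \<in> space \<rho> \<Longrightarrow> \<bar>f x\<bar> \<le> M"
    and "S \<in> sets \<rho>" "\<And>x. x \<in> S \<Longrightarrow> \<bar>f x\<bar> \<ge> b" "b \<ge> 0"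
  shows "L2_norm \<rho> f \<ge> b * sqrt (measure \<rho> S)"
proof -
  interpret prob_space \<rho> by fact
  have "b\<^sup>2 * measure \<rho> S = (\<integral>x. b\<^sup>2 * indicator S x \<partial>\<rho>)"
    using assms by simp
  also have "\<dots> \<le> (\<integral>x. \<bar>f x\<bar>\<^sup>2 \<partial>\<rho>)"
  proof (rule integral_mono)
    show "integrable \<rho> (\<lambda>x. \<bar>f x\<bar>\<^sup>2)"
    proof (rule integrable_const_bound[where B = "M\<^sup>2"])
      show "AE x in \<rho>. norm (\<bar>f x\<bar>\<^sup>2) \<le> M\<^sup>2"
      proof (intro AE_I2)
        fix x assume "x \<in> space \<rho>"
        then have "\<bar>f x\<bar>\<^sup>2 \<le> M\<^sup>2"
          by (intro power_mono assms(3)) auto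
        then show "norm (\<bar>f x\<bar>\<^sup>2) \<le> M\<^sup>2"
          by (simp only: real_norm_def abs_power2)
      qed
    qed (use assms in measurable)
    show "b\<^sup>2 * indicator S x \<le> \<bar>f x\<bar>\<^sup>2" for x
      using assms(5)[of x] assms(6) power_mono[of b "\<bar>f x\<bar>" 2] by (cases "x \<in> S") auto
    show "integrable \<rho> (\<lambda>x. b\<^sup>2 * indicator S x)"
      using assms(4) by (intro integrable_mult_right integrable_real_indicator) (auto simp: less_top[symmetric])
  qed
  finally have "sqrt (b\<^sup>2 * measure \<rho> S) \<le> L2_norm \<rho> f"
    unfolding L2_norm_def by (rule real_sqrt_le_mono)
  then show ?thesis
    using assms by (simp add: real_sqrt_mult)
qed

text \<open>Padding with 1 yields exactly k zeros however few samples there are. The extra zeros lie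
  in [1 - d, 1], as the genuine ones will.\<close>

lemma enumerate_padded:
  fixes y :: "nat \<Rightarrow> real"
  assumes "finite T" "card T \<le> k"
  obtains z where "\<And>i. i \<in> T \<Longrightarrow> y i \<in> z ` {..<k}" "\<And>j. z j = 1 \<or> z j \<in> y ` T"
proof -
  obtain h where h: "bij_betw h {0..<card T} T"
    using ex_bij_betw_nat_finite[OF assms(1)] by blast
  define z where "z j = (if j < card T then y (h j) else 1)" for j
  show thesis
  proof (rule that)
    fix i assume "i \<in> T"
    then obtain j where j: "j < card T" "h j = i"
      using h by (force simp: bij_betw_def)
    then show "y i \<in> z ` {..<k}"
      using assms(2) by (intro image_eqI[of _ _ j]) (auto simp: z_def)
  next
    show "z j = 1 \<or> z j \<in> y ` T" for j
      using h by (auto simp: z_def bij_betw_def)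
  qed
qed

text \<open>Its square times N powr (-2 (1 + \<gamma>)) is a lower bound for the mass of the set
  where the test polynomial is large: \<open>measure_jacobi_near_endpoint_ge\<close> with e = 1 / (2
  N^2) for d and e / 4 for l.\<close>

definition jacobi_lower_const :: "real \<Rightarrow> real \<Rightarrow> real \<Rightarrow> real \<Rightarrow> real" where
  "jacobi_lower_const \<alpha> \<beta> \<gamma> \<delta> =
     sqrt (jacobi_const \<alpha> \<beta> * min 1 (2 powr (-\<gamma>)) * min 1 (2 powr \<delta>) / (4 * 2 powr (1 + \<gamma>)))"

text \<open>The test polynomial is at least (exp(-18) N^2 / 4)^k on a set near the endpoint and at
  most (4 / d)^k at the samples; the hypothesis on N^2 d makes the quotient of the two bases at
  least exp 1. Its degree is at most \<open>k + 4 * N * k\<close>, from k zeros and 4 k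
  kernels.\<close>

lemma cond_number_ge_if_gap:
  fixes \<alpha> \<beta> \<sigma> \<gamma> \<delta> d :: real
  assumes ab: "\<alpha> > -1" "\<beta> > -1" and \<sigma>: "\<sigma> = 1 \<or> \<sigma> = -1"
    and w: "\<And>x. jacobi_weight \<alpha> \<beta> x
       = jacobi_const \<alpha> \<beta> * (1 - \<sigma> * x) powr \<gamma> * (1 + \<sigma> * x) powr \<delta>"
    and x: "x \<in> {1..n} \<rightarrow> {-1..1}" "inj_on x {1..n}" "m < n"
    and few: "card {i \<in> {1..n}. x i \<in> {t \<in> {-1..1}. \<sigma> * t > 1 - d}} \<le> k"
    and d: "d > 0" and N: "N > 0" "(real N)\<^sup>2 * d \<ge> 16 * exp 19" and k: "k > 0" "k + 4 * N * k \<le> m"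
  shows "cond_number (jacobi_measure \<alpha> \<beta>) m n x
     \<ge> ereal (jacobi_lower_const \<alpha> \<beta> \<gamma> \<delta> * real N powr (-(1 + \<gamma>)) * exp k)"
proof -
  let ?\<rho> = "jacobi_measure \<alpha> \<beta>"
  define T where "T = {i \<in> {1..n}. x i \<in> {t \<in> {-1..1}. \<sigma> * t > 1 - d}}"
  obtain z where z: "\<And>i. i \<in> T \<Longrightarrow> \<sigma> * x i \<in> z ` {..<k}" "\<And>j. z j = 1 \<or> z j \<in> (\<lambda>i. \<sigma> * x i) ` T"
    using enumerate_padded[of T k "\<lambda>i. \<sigma> * x i"] few by (auto simp: T_def)
  have sx: "\<sigma> * x i \<in> {-1..1}" if "i \<in> {1..n}" for i
    using x(1) that \<sigma> by (auto simp: Pi_iff minus_le_iff)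
  have z_range: "z j \<in> {1 - d..1}" for j
    using z(2)[of j] d sx by (auto simp: T_def)
  \<comment> \<open>Each zero is paired with a fourth power of the kernel: at the samples such a
    pair is at most 4 / d, while near the peak N^4 outweighs a zero factor of order 1 / N^2.\<close>
  define q where "q = (\<Prod>j<k. [:- z j, 1:]) * dirichlet_poly N ^ (4 * k)"
  \<comment> \<open>The kernel peaks at 1; the reflection moves the peak to \<sigma>.\<close>
  define p where "p = pcompose q [:0, \<sigma>:]"
  have poly_q: "poly q y = (\<Prod>j<k. y - z j) * poly (dirichlet_poly N) y ^ (4 * k)" for y
    by (simp add: q_def poly_prod)
  have poly_p: "poly p t = poly q (\<sigma> * t)" for t
    by (simp add: p_def poly_pcompose mult.commute)
  have "degree (\<Prod>j<k. [:- z j, 1:]) \<le> k"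
    using degree_prod_sum_le[of "{..<k}" "\<lambda>j. [:- z j, 1:]"] by simp
  moreover have "degree (dirichlet_poly N ^ (4 * k)) \<le> N * (4 * k)"
    using degree_power_le[of "dirichlet_poly N" "4 * k"] degree_dirichlet_poly[of N]
    by (meson le_trans mult_le_mono1)
  ultimately have "degree q \<le> k + N * (4 * k)"
    unfolding q_def using degree_mult_le le_trans add_mono by blast
  moreover have "degree p \<le> degree q"
    using degree_pcompose_le[of q "[:0, \<sigma>:]"] \<sigma> by (auto simp: p_def)
  ultimately have deg: "degree p \<le> m"
    using k by (simp add: mult_ac)

  have "\<bar>poly p (x i)\<bar> \<le> (4 / d) ^ k" if i: "i \<in> {1..n}" for i
  proof (cases "i \<in> T")
    case True
    then have "(\<Prod>j<k. \<sigma> * x i - z j) = 0"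
      using z(1)[OF True] by (intro prod_zero) auto
    then have "poly p (x i) = 0"
      by (simp only: poly_p poly_q mult_zero_left)
    then show ?thesis
      using d by simp
  next
    case False
    define y where "y = \<sigma> * x i"
    have y: "\<bar>y\<bar> \<le> 1" "d \<le> 1 - y"
      using False sx[OF i] i x(1) by (auto simp: T_def y_def Pi_iff)
    define D where "D = poly (dirichlet_poly N) y"
    \<comment> \<open>Here y <= 1 - d <= z j <= 1, so y is within 1 - y of every zero.\<close>
    have "\<bar>\<Prod>j<k. y - z j\<bar> \<le> (1 - y) ^ k"
    proof -
      have "\<bar>y - z j\<bar> \<le> 1 - y" for j
        using y z_range[of j] by auto
      then have "\<bar>\<Prod>j<k. y - z j\<bar> \<le> (\<Prod>j<k. 1 - y)"
        unfolding abs_prod by (intro prod_mono) auto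
      then show ?thesis by simp
    qed
    then have "\<bar>poly q y\<bar> \<le> (1 - y) ^ k * \<bar>D ^ (4 * k)\<bar>"
      by (simp add: poly_q D_def abs_mult mult_right_mono)
    also have "D ^ (4 * k) = ((D\<^sup>2)\<^sup>2) ^ k"
      by (simp flip: power_mult)
    also have "(1 - y) ^ k * \<bar>((D\<^sup>2)\<^sup>2) ^ k\<bar> = ((1 - y) * (D\<^sup>2)\<^sup>2) ^ k"
      by (simp add: power_mult_distrib)
    also have "\<dots> \<le> (4 / d) ^ k"
    proof (intro power_mono)
      have "(1 - y) * (D\<^sup>2)\<^sup>2 = (D\<^sup>2 * (1 - y))\<^sup>2 / (1 - y)"
        using y d by (simp add: power2_eq_square)
      also have "\<dots> \<le> 2\<^sup>2 / d"
        using y d unfolding D_def by (intro frac_le power_mono dirichlet_poly_decay) auto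
      finally show "(1 - y) * (D\<^sup>2)\<^sup>2 \<le> 4 / d"
        by simp
    qed (use y d in auto)
    finally show ?thesis
      by (simp add: poly_p y_def)
  qed
  then have emp: "emp_norm n x (poly p) \<le> (4 / d) ^ k"
    using d by (intro emp_norm_le) auto

  \<comment> \<open>The radius up to which \<open>dirichlet_poly_ge\<close> applies.\<close>
  define e where "e = 1 / (2 * (real N)\<^sup>2)"
  have "1 \<le> (real N)\<^sup>2"
    using N(1) by (intro one_le_power) simp
  moreover have "0 < 1 / (2 * t) \<and> 1 / (2 * t) \<le> 1" if "1 \<le> t" for t :: real
    using that by (simp add: field_simps)
  ultimately have e: "0 < e" "e \<le> 1"
    unfolding e_def by blast+
  \<comment> \<open>S is sought in [1 - e, 1 - e / 2], away from the endpoint, where the weight is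
    comparable to e powr \<gamma>; half of the length e / 2 remains.\<close>
  obtain S where S: "S \<in> sets borel" "S \<subseteq> {1 - e..1 - e + e / 2}"
      "emeasure lborel S \<ge> ennreal (e / 2 / 2)"
      "\<And>y. y \<in> S \<Longrightarrow> \<bar>\<Prod>j<k. y - z j\<bar> \<ge> (exp (-18) * (e / 2)) ^ k"
    using monic_product_large_on_half[of "e / 2" k "1 - e" z] e k by auto
  define S' where "S' = {t \<in> {-1..1}. \<sigma> * t \<in> S}"
  define b where "b = (exp (-18) * (real N)\<^sup>2 / 4) ^ k"
  have big: "\<bar>poly p t\<bar> \<ge> b" if "t \<in> S'" for t
  proof -
    define y where "y = \<sigma> * t"
    have y: "y \<in> S" "1 - e \<le> y" "y \<le> 1"
      using that S(2) e by (auto simp: S'_def y_def)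
    have "poly (dirichlet_poly N) y \<ge> real N"
    proof (rule dirichlet_poly_ge)
      show "\<bar>y\<bar> \<le> 1"
        using y e by auto
      have "2 * (real N)\<^sup>2 * (1 - y) \<le> 2 * (real N)\<^sup>2 * e"
        using y by (intro mult_left_mono) auto
      then show "2 * (real N)\<^sup>2 * (1 - y) \<le> 1"
        using N by (simp add: e_def)
    qed
    then have "(real N) ^ (4 * k) \<le> \<bar>poly (dirichlet_poly N) y ^ (4 * k)\<bar>"
      by (simp add: power_abs power_mono)
    then have "(exp (-18) * (e / 2)) ^ k * (real N) ^ (4 * k) \<le> \<bar>poly q y\<bar>"
      unfolding poly_q abs_mult using S(4)[OF y(1)] e by (intro mult_mono) auto
    also have "(exp (-18) * (e / 2)) ^ k * (real N) ^ (4 * k) = (exp (-18) * (e / 2) * real N ^ 4) ^ k"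
      by (simp only: power_mult_distrib power_mult)
    also have "exp (-18) * (e / 2) * real N ^ 4 = exp (-18) * (real N)\<^sup>2 / 4"
      using N by (simp add: e_def power2_eq_square power4_eq_xxxx)
    also have "\<dots> ^ k = b"
      by (simp only: b_def)
    finally show ?thesis
      by (simp add: poly_p y_def)
  qed
  have b: "b > 0"
    using N by (simp add: b_def)
  note [measurable] = S(1)
  have [measurable]: "S' \<in> sets borel"
    unfolding S'_def by measurable
  have S'_sets: "S' \<in> sets ?\<rho>"
    by (intro in_sets_jacobi_measure) (auto simp: S'_def)
  have "compact ((\<lambda>t. \<bar>poly p t\<bar>) ` {-1..1})"
    by (intro compact_continuous_image continuous_intros) auto
  then obtain M where M: "\<And>t. t \<in> {-1..1} \<Longrightarrow> \<bar>poly p t\<bar> \<le> M"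
    by (force dest!: compact_imp_bounded simp: bounded_iff)
  have "(\<lambda>t. poly p t) \<in> borel_measurable ?\<rho>"
    by (intro borel_measurable_jacobi_measure borel_measurable_continuous_onI continuous_intros)
  then have L2: "L2_norm ?\<rho> (poly p) \<ge> b * sqrt (measure ?\<rho> S')"
    using M big b S'_sets ab by (intro L2_norm_ge_on_set[where M = M] prob_space_jacobi_measure) auto
  have "measure ?\<rho> S' \<ge> jacobi_const \<alpha> \<beta> * min 1 (2 powr (-\<gamma>)) * min 1 (2 powr \<delta>) * e powr \<gamma> * (e / 2 / 2)"
    unfolding S'_def using S e by (intro measure_jacobi_near_endpoint_ge[OF ab \<sigma> w]) auto
  also have "jacobi_const \<alpha> \<beta> * min 1 (2 powr (-\<gamma>)) * min 1 (2 powr \<delta>) * e powr \<gamma> * (e / 2 / 2)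
      = jacobi_const \<alpha> \<beta> * min 1 (2 powr (-\<gamma>)) * min 1 (2 powr \<delta>) / 4 * e powr (1 + \<gamma>)"
    using e by (simp add: powr_add)
  also have "e powr (1 + \<gamma>) = (real N powr (-(1 + \<gamma>)))\<^sup>2 / 2 powr (1 + \<gamma>)"
  proof -
    have "(1 / (2 * t\<^sup>2)) powr c = (t powr (-c))\<^sup>2 / 2 powr c" if "t > 0" for t c :: real
      using that by (simp add: powr_divide powr_mult power2_eq_square powr_minus_divide)
    then show ?thesis
      using N unfolding e_def by (simp only: of_nat_0_less_iff)
  qed
  finally have "jacobi_lower_const \<alpha> \<beta> \<gamma> \<delta> * real N powr (-(1 + \<gamma>)) \<le> sqrt (measure ?\<rho> S')"
    unfolding jacobi_lower_const_def by (intro real_le_rsqrt)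
      (use jacobi_const_pos[OF ab] in \<open>simp add: power_mult_distrib\<close>)
  then have "b * (jacobi_lower_const \<alpha> \<beta> \<gamma> \<delta> * real N powr (-(1 + \<gamma>))) \<le> L2_norm ?\<rho> (poly p)"
    using L2 b by (meson mult_left_mono order_trans less_imp_le)
  moreover have "exp k * (4 / d) ^ k \<le> b"
  proof -
    have "exp 1 * (4 / d) \<le> exp (-18) * (real N)\<^sup>2 / 4"
    proof -
      have "exp 1 = exp (-18) * exp (19 :: real)"
        by (simp flip: exp_add)
      then have "exp 1 * (4 / d) = exp (-18) * (exp 19 * (4 / d))"
        by (simp only: mult.assoc)
      also have "\<dots> \<le> exp (-18) * ((real N)\<^sup>2 / 4)"
        using N d by (intro mult_left_mono) (auto simp: field_simps)
      finally show ?thesis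
        by simp
    qed
    then have "(exp 1 * (4 / d)) ^ k \<le> b"
      unfolding b_def using d by (intro power_mono) auto
    moreover have "exp (real k) = exp 1 ^ k"
      using exp_of_nat_mult[of k "1 :: real"] by simp
    ultimately show ?thesis
      by (simp only: power_mult_distrib)
  qed
  moreover have C0: "jacobi_lower_const \<alpha> \<beta> \<gamma> \<delta> * real N powr (-(1 + \<gamma>)) \<ge> 0"
    using jacobi_const_pos[OF ab] by (simp add: jacobi_lower_const_def)
  ultimately have "exp k * (4 / d) ^ k * (jacobi_lower_const \<alpha> \<beta> \<gamma> \<delta> * real N powr (-(1 + \<gamma>)))
      \<le> L2_norm ?\<rho> (poly p)"
    by (meson mult_right_mono order_trans)
  then have L2': "jacobi_lower_const \<alpha> \<beta> \<gamma> \<delta> * real N powr (-(1 + \<gamma>)) * exp k * (4 / d) ^ k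
      \<le> L2_norm ?\<rho> (poly p)"
    by (simp only: mult_ac)
  have "p \<noteq> 0"
  proof -
    have "S' \<noteq> {}"
    proof -
      have "S \<noteq> {}"
        using S(3) e by auto
      then obtain y where "y \<in> S"
        by blast
      then have "\<sigma> * y \<in> S'"
        using S(2) e \<sigma> by (auto simp: S'_def)
      then show ?thesis
        by blast
    qed
    then show ?thesis
      using big b by force
  qed
  have emp0: "emp_norm n x (poly p) > 0"
    using x deg \<open>p \<noteq> 0\<close> by (intro emp_norm_poly_pos)
  have "jacobi_lower_const \<alpha> \<beta> \<gamma> \<delta> * real N powr (-(1 + \<gamma>)) * exp k
     \<le> L2_norm ?\<rho> (poly p) / emp_norm n x (poly p)"
  proof -
    have "jacobi_lower_const \<alpha> \<beta> \<gamma> \<delta> * real N powr (-(1 + \<gamma>)) * exp k * emp_norm n x (poly p)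
      \<le> jacobi_lower_const \<alpha> \<beta> \<gamma> \<delta> * real N powr (-(1 + \<gamma>)) * exp k * (4 / d) ^ k"
      using emp C0 by (intro mult_left_mono) auto
    then show ?thesis
      using L2' emp0 by (simp add: pos_le_divide_eq)
  qed
  also have "ereal \<dots> \<le> cond_number ?\<rho> m n x"
    using x deg \<open>p \<noteq> 0\<close> by (intro cond_number_ge_poly)
  finally show ?thesis by simp
qed

section \<open>Choice of the parameters\<close>

text \<open>The degree is of order N k, with N of order d powr (-1/2). With t = 1 / (2 (1 +
  \<gamma>)) and \<omega> = 1 - t, the left side is k powr \<omega> * n powr ((1 + s) t); the
  exponent r of the theorem is the one with r \<omega> + (1 + s) t = \<tau>.\<close>

lemma degree_budget:
  fixes \<gamma> \<tau> s c k :: real and n :: nat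
  assumes "\<gamma> > -1/2" "n > 0" "k > 0" "c > 0"
    and k: "k \<le> c * real n powr ((2 * (1 + \<gamma>) * \<tau> - 1 - s) / (1 + 2 * \<gamma>))"
    and d: "d = (k * real n powr (-(1 + s))) powr (1 / (1 + \<gamma>))"
  shows "k * d powr (-1/2) \<le> c powr ((1 + 2 * \<gamma>) / (2 * (1 + \<gamma>))) * real n powr \<tau>"
proof -
  define \<omega> where "\<omega> = (1 + 2 * \<gamma>) / (2 * (1 + \<gamma>))"
  define r where "r = (2 * (1 + \<gamma>) * \<tau> - 1 - s) / (1 + 2 * \<gamma>)"
  define t where "t = 1 / (2 * (1 + \<gamma>))"
  have pos: "1 + \<gamma> > 0" "1 + 2 * \<gamma> > 0"
    using assms by auto
  have \<omega>: "\<omega> > 0" "\<omega> = 1 - t"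
    using pos by (auto simp: \<omega>_def t_def field_simps)
  have "(2 * (1 + \<gamma>) * \<tau> - 1 - s) / (2 * (1 + \<gamma>)) = r * \<omega>"
    using pos by (simp add: \<omega>_def r_def)
  then have r: "r * \<omega> + (1 + s) * t = \<tau>"
    using pos by (simp add: t_def field_simps)
  have "k * d powr (-1/2) = k powr 1 * (k * real n powr (-(1 + s))) powr (- t)"
  proof -
    have "1 / (1 + \<gamma>) * (-1/2) = -t"
      using pos by (simp add: t_def field_simps)
    then show ?thesis
      using \<open>k > 0\<close> unfolding d powr_powr by simp
  qed
  also have "\<dots> = k powr \<omega> * real n powr ((1 + s) * t)"
  proof -
    have "(k * real n powr (-(1 + s))) powr (-t) = k powr (-t) * real n powr ((1 + s) * t)"
      using \<open>k > 0\<close> by (subst powr_mult) (simp_all only: powr_powr minus_mult_minus less_imp_le powr_ge_zero)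
    moreover have "k powr \<omega> = k powr 1 * k powr (-t)"
      unfolding \<omega>(2) diff_conv_add_uminus by (rule powr_add)
    ultimately show ?thesis
      by simp
  qed
  also have "\<dots> \<le> (c * real n powr r) powr \<omega> * real n powr ((1 + s) * t)"
    using k \<open>k > 0\<close> \<omega> unfolding r_def[symmetric] by (intro mult_right_mono powr_mono2) auto
  also have "\<dots> = c powr \<omega> * real n powr \<tau>"
    using \<open>c > 0\<close> by (simp add: powr_mult powr_powr mult.assoc r flip: powr_add)
  finally show ?thesis
    by (simp add: \<omega>_def)
qed

text \<open>Raising to the power \<tau> in (0, 1] gives the constants a1 powr \<tau> and a2 powr
  \<tau>. They are replaced by bounds free of \<tau>, because \<eta> and \<nu> are chosen before
  \<tau>.\<close>

lemma powr_two_sided_bounds: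
  fixes a1 a2 \<tau> M n :: real
  assumes "a1 > 0" "a2 > 0" "0 < \<tau>" "\<tau> \<le> 1" "M \<ge> 0" "n > 0"
    and "a1 * M powr (1 / \<tau>) \<le> n" "n \<le> a2 * M powr (1 / \<tau>)"
  shows "min 1 a1 * M \<le> n powr \<tau>" "n powr \<tau> \<le> max 1 a2 * M"
proof -
  have "(M powr (1 / \<tau>)) powr \<tau> = M"
    using assms by (simp add: powr_powr)
  then have eq: "(a * M powr (1 / \<tau>)) powr \<tau> = a powr \<tau> * M" if "a > 0" for a
    using that by (simp add: powr_mult)
  have "min 1 a1 powr 1 \<le> min 1 a1 powr \<tau>"
    using assms by (intro powr_mono') auto
  also have "\<dots> \<le> a1 powr \<tau>"
    using assms by (intro powr_mono2) auto
  finally have "min 1 a1 * M \<le> a1 powr \<tau> * M"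
    using assms by (intro mult_right_mono) auto
  also have "\<dots> \<le> n powr \<tau>"
    unfolding eq[OF \<open>a1 > 0\<close>, symmetric] using assms by (intro powr_mono2) auto
  finally show "min 1 a1 * M \<le> n powr \<tau>" .
  have "n powr \<tau> \<le> a2 powr \<tau> * M"
    unfolding eq[OF \<open>a2 > 0\<close>, symmetric] using assms by (intro powr_mono2) auto
  also have "a2 powr \<tau> \<le> max 1 a2 powr \<tau>"
    using assms by (intro powr_mono2) auto
  also have "\<dots> \<le> max 1 a2 powr 1"
    using assms by (intro powr_mono) auto
  finally show "n powr \<tau> \<le> max 1 a2 * M"
    using assms by (simp add: mult_right_mono)
qed

theorem theorem1p4:
  fixes \<alpha> \<beta> \<gamma> cbar a1 a2 :: real
  assumes "\<alpha> > -1" and "\<beta> > -1"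
    and "\<gamma> = max \<alpha> \<beta>" and "\<gamma> > -1/2"
    and "cbar = jacobi_const \<alpha> \<beta> * 2 powr (min \<alpha> \<beta>) / (1 + \<gamma>)"
    and "a1 > 0" and "a2 > 0"
  shows "\<exists>\<eta>>0. \<exists>\<nu>>1. \<forall>(\<tau>::real) (m :: nat \<Rightarrow> nat) (s::real).
    0 < \<tau> \<and> \<tau> \<le> 1 \<and> \<tau> > 1 / (2 * (1 + \<gamma>)) \<and>
    (\<forall>\<^sub>F n in sequentially. m n < n \<and>
       a1 * real (m n) powr (1 / \<tau>) \<le> real n \<and> real n \<le> a2 * real (m n) powr (1 / \<tau>)) \<and>
    0 < s \<and> s < 2 * (1 + \<gamma>) * \<tau> - 1 \<longrightarrow>
    (\<forall>\<^sub>F n in sequentially.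
       \<exists>A \<in> sets (sample_measure \<alpha> \<beta> n).
         measure (sample_measure \<alpha> \<beta> n) A \<ge> 1 - 2 * (exp 1)\<^sup>2 * cbar / real n powr s \<and>
         (\<forall>x\<in>A. cond_number (jacobi_measure \<alpha> \<beta>) (m n) n x \<ge>
            ereal (\<eta> / real n powr ((1 + \<gamma>) * \<tau>) *
              \<nu> powr (real n powr ((2 * (1 + \<gamma>) * \<tau> - 1 - s) / (1 + 2 * \<gamma>))))))"
proof -
  define \<delta> where "\<delta> = min \<alpha> \<beta>"
  obtain \<sigma> :: real where \<sigma>: "\<sigma> = 1 \<or> \<sigma> = -1"
    and w: "\<And>x. jacobi_weight \<alpha> \<beta> x
       = jacobi_const \<alpha> \<beta> * (1 - \<sigma> * x) powr \<gamma> * (1 + \<sigma> * x) powr \<delta>"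
    using jacobi_weight_endpoint[of \<alpha> \<beta>] assms(3) unfolding \<delta>_def by metis
  have pos: "1 + \<gamma> > 0" "1 + 2 * \<gamma> > 0" "\<delta> > -1"
    using assms by (auto simp: \<delta>_def)
  have jc: "jacobi_const \<alpha> \<beta> > 0"
    using assms by (intro jacobi_const_pos)
  have cbar: "cbar > 0"
    using jc pos assms by simp
  define B where "B = 16 * exp (19 :: real)"
  define \<omega> where "\<omega> = (1 + 2 * \<gamma>) / (2 * (1 + \<gamma>))"
  \<comment> \<open>Chosen so that 10 * sqrt B * c powr \<omega> * n powr \<tau> equals n powr
    \<tau> / max 1 a2, which is at most m; this makes the degree fit. Neither \<tau> nor s
    enters.\<close>
  define c where "c = (1 / (10 * sqrt B * max 1 a2)) powr (1 / \<omega>)"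
  \<comment> \<open>The factor with a1 comes from N <= m <= n powr \<tau> / min 1 a1, which converts
    the power of N into a power of n.\<close>
  define \<eta> where "\<eta> = jacobi_lower_const \<alpha> \<beta> \<gamma> \<delta> * min 1 a1 powr (1 + \<gamma>)"
  have B: "B \<ge> 1"
    using one_le_exp_iff[of "19 :: real"] unfolding B_def by linarith
  have \<omega>: "\<omega> > 0"
    using pos by (simp add: \<omega>_def)
  have c: "c > 0" "c powr \<omega> = 1 / (10 * sqrt B * max 1 a2)"
    using B \<omega> by (auto simp: c_def powr_powr)
  have \<eta>: "\<eta> > 0"
    using jc assms(6) by (simp add: \<eta>_def jacobi_lower_const_def)

  have main: "\<exists>A \<in> sets (sample_measure \<alpha> \<beta> n).
         measure (sample_measure \<alpha> \<beta> n) A \<ge> 1 - 2 * (exp 1)\<^sup>2 * cbar / real n powr s \<and>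
         (\<forall>x\<in>A. cond_number (jacobi_measure \<alpha> \<beta>) m n x \<ge>
            ereal (\<eta> / real n powr ((1 + \<gamma>) * \<tau>) * exp (c / 2) powr (real n powr r)))"
    if \<tau>: "0 < \<tau>" "\<tau> \<le> 1" and r: "r = (2 * (1 + \<gamma>) * \<tau> - 1 - s) / (1 + 2 * \<gamma>)"
      and n: "n > 0" "m < n" and m: "a1 * real m powr (1 / \<tau>) \<le> real n" "real n \<le> a2 * real m powr (1 / \<tau>)"
      and large: "c * real n powr r \<ge> 2" and small: "c * real n powr (r - (1 + s)) \<le> 1"
    for \<tau> s r :: real and n m :: nat
  proof -
    \<comment> \<open>By \<open>large\<close> the floor is positive and at least half of its
      argument; this loss is why \<nu> = exp (c / 2).\<close>
    define k where "k = nat \<lfloor>c * real n powr r\<rfloor>"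
    have k: "real k \<le> c * real n powr r" "c / 2 * real n powr r \<le> real k" "k > 0"
      using large unfolding k_def by linarith+
    \<comment> \<open>With this d the expected number of samples near the endpoint is at most 2 *
      cbar * k / n powr s, so Markov's inequality cancels k. By \<open>small\<close>, d is at most
      1.\<close>
    define d where "d = (real k * real n powr (-(1 + s))) powr (1 / (1 + \<gamma>))"
    have "real k * real n powr (-(1 + s)) \<le> c * real n powr r * real n powr (-(1 + s))"
      using k by (intro mult_right_mono) auto
    also have "\<dots> = c * real n powr (r - (1 + s))"
      by (simp only: diff_conv_add_uminus mult.assoc powr_add)
    finally have kn: "real k * real n powr (-(1 + s)) \<le> 1"
      using small by simp
    have d: "d > 0" "d \<le> 1" "d powr (1 + \<gamma>) = real k * real n powr (-(1 + s))"
      using k n kn pos by (auto simp: d_def powr_powr intro!: powr_le1)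
    \<comment> \<open>The least N with N^2 d >= B. As B / d >= 1, rounding up at most doubles the
      square root.\<close>
    define N where "N = nat \<lceil>sqrt (B / d)\<rceil>"
    have Bd: "B / d \<ge> 1"
      using B d by (simp add: field_simps)
    then have Bd': "sqrt (B / d) \<ge> 1"
      by simp
    have N: "real N \<ge> sqrt (B / d)" "real N \<le> 2 * sqrt (B / d)" "N > 0"
      using Bd' unfolding N_def by linarith+
    have "(sqrt (B / d))\<^sup>2 \<le> (real N)\<^sup>2"
      using N Bd' by (intro power_mono) auto
    then have Nd: "(real N)\<^sup>2 * d \<ge> 16 * exp 19"
      using Bd d by (simp add: B_def field_simps)
    have "real k \<le> real N * real k"
      using N(3) mult_right_mono[of 1 "real N" "real k"] by simp
    then have "real (k + 4 * N * k) \<le> 5 * real N * real k"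
      by simp
    also have "\<dots> \<le> 5 * (2 * sqrt (B / d)) * real k"
      using N(2) Bd by (intro mult_mono) auto
    also have "\<dots> = 10 * sqrt B * (real k * d powr (-1/2))"
    proof -
      have "d powr (-1/2) = 1 / sqrt d"
        using d by (simp add: powr_minus_divide powr_half_sqrt)
      then show ?thesis
        by (simp only: real_sqrt_divide) simp
    qed
    also have "\<dots> \<le> 10 * sqrt B * (c powr \<omega> * real n powr \<tau>)"
      unfolding \<omega>_def
      by (intro mult_left_mono degree_budget[where s = s])
         (use B n k c assms(4) in \<open>auto simp: r d_def\<close>)
    also have "\<dots> = real n powr \<tau> / max 1 a2"
      using B by (simp add: c(2) field_simps)
    also have "\<dots> \<le> real m"
      using powr_two_sided_bounds(2)[OF assms(6,7) \<tau> _ _ m] n by (simp add: field_simps)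
    finally have deg: "k + 4 * N * k \<le> m"
      by (simp only: of_nat_le_iff)
    have "N \<le> N * k"
      using k by simp
    also have "\<dots> \<le> m"
      using deg by (simp add: mult.assoc)
    finally have "N \<le> m" .
    then have "min 1 a1 * real N \<le> min 1 a1 * real m"
      using assms by (intro mult_left_mono) auto
    also have "\<dots> \<le> real n powr \<tau>"
      using powr_two_sided_bounds(1)[OF assms(6,7) \<tau> _ _ m] n by simp
    finally have N_le: "(min 1 a1 * real N) powr (1 + \<gamma>) \<le> (real n powr \<tau>) powr (1 + \<gamma>)"
      using pos assms by (intro powr_mono2) auto
    have powr_le: "a powr P / M powr (P * \<tau>) \<le> L powr (-P)"
      if "(a * L) powr P \<le> (M powr \<tau>) powr P" "a > 0" "L > 0" "M > 0" for a L M P :: real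
      using that by (simp add: powr_mult powr_powr powr_minus_divide field_simps)
    from N_le have "min 1 a1 powr (1 + \<gamma>) / real n powr ((1 + \<gamma>) * \<tau>) \<le> real N powr (-(1 + \<gamma>))"
      by (rule powr_le) (use N n assms(6) in auto)
    then have poly_factor: "\<eta> / real n powr ((1 + \<gamma>) * \<tau>)
        \<le> jacobi_lower_const \<alpha> \<beta> \<gamma> \<delta> * real N powr (-(1 + \<gamma>))"
      using jc unfolding \<eta>_def times_divide_eq_right[symmetric]
      by (intro mult_left_mono) (auto simp: jacobi_lower_const_def)
    have "exp (c / 2) powr (real n powr r) \<le> exp k"
      using k by (simp add: exp_powr_real)
    then have final: "\<eta> / real n powr ((1 + \<gamma>) * \<tau>) * exp (c / 2) powr (real n powr r)
        \<le> jacobi_lower_const \<alpha> \<beta> \<gamma> \<delta> * real N powr (-(1 + \<gamma>)) * exp k"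
      using poly_factor jc by (intro mult_mono) (auto simp: jacobi_lower_const_def)

    define E where "E = {t \<in> {-1..1}. \<sigma> * t > 1 - d}"
    have E: "E \<in> sets (jacobi_measure \<alpha> \<beta>)"
      unfolding E_def by (intro in_sets_jacobi_measure) auto
    have id_meas: "(\<lambda>x. x) \<in> borel_measurable (jacobi_measure \<alpha> \<beta>)"
      by (intro borel_measurable_jacobi_measure) auto
    obtain A where A: "A \<in> sets (sample_measure \<alpha> \<beta> n)"
      "measure (sample_measure \<alpha> \<beta> n) A \<ge> 1 - card {1..n} * measure (jacobi_measure \<alpha> \<beta>) E / (real k + 1)"
      "\<And>x. x \<in> A \<Longrightarrow> x \<in> {1..n} \<rightarrow> {-1..1} \<and> inj_on x {1..n} \<and> card {i \<in> {1..n}. x i \<in> E} \<le> k"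
      using sample_event[OF prob_space_jacobi_measure[OF assms(1,2)] id_meas
          emeasure_jacobi_measure_singleton E, where I = "{1..n}" and k = k]
      unfolding sample_measure_def by auto
    have "measure (jacobi_measure \<alpha> \<beta>) E \<le> 2 * cbar * d powr (1 + \<gamma>)"
      unfolding E_def assms(5) \<delta>_def[symmetric]
      using assms pos d by (intro measure_jacobi_tail_le[OF assms(1,2) \<sigma> w]) auto
    then have "real n * measure (jacobi_measure \<alpha> \<beta>) E / (real k + 1)
       \<le> real n * (2 * cbar * (real k * real n powr (-(1 + s)))) / (real k + 1)"
      unfolding d(3) by (intro divide_right_mono mult_left_mono) auto
    also have "\<dots> = 2 * cbar / real n powr s * (real k / (real k + 1))"
      using n by (simp add: powr_add powr_minus powr_diff field_simps)
    also have "\<dots> \<le> 2 * cbar / real n powr s * (exp 1)\<^sup>2"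
    proof (intro mult_left_mono)
      have "real k / (real k + 1) \<le> 1"
        by simp
      also have "1 \<le> (exp (1 :: real))\<^sup>2"
        by (intro one_le_power) simp
      finally show "real k / (real k + 1) \<le> (exp 1)\<^sup>2" .
    qed (use cbar in simp)
    finally have prob: "measure (sample_measure \<alpha> \<beta> n) A \<ge> 1 - 2 * (exp 1)\<^sup>2 * cbar / real n powr s"
      using A(2) by (simp add: mult_ac)
    show ?thesis
    proof (intro bexI[OF _ A(1)] conjI ballI prob)
      fix x assume "x \<in> A"
      then have "ereal (jacobi_lower_const \<alpha> \<beta> \<gamma> \<delta> * real N powr (-(1 + \<gamma>)) * exp k)
          \<le> cond_number (jacobi_measure \<alpha> \<beta>) m n x"
        using A(3)[of x] n d N k deg Nd unfolding E_def
        by (intro cond_number_ge_if_gap[OF assms(1,2) \<sigma> w]) auto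
      then show "ereal (\<eta> / real n powr ((1 + \<gamma>) * \<tau>) * exp (c / 2) powr (real n powr r))
          \<le> cond_number (jacobi_measure \<alpha> \<beta>) m n x"
        using final by (meson ereal_less_eq(3) order_trans)
    qed
  qed

  show ?thesis
  proof (rule exI[of _ \<eta>], rule conjI[OF \<eta>], rule exI[of _ "exp (c / 2)"], intro conjI allI impI; (elim conjE)?)
    fix \<tau> s :: real and m :: "nat \<Rightarrow> nat"
    assume \<tau>: "0 < \<tau>" "\<tau> \<le> 1" and s: "0 < s" "s < 2 * (1 + \<gamma>) * \<tau> - 1"
      and ev: "\<forall>\<^sub>F n in sequentially. m n < n \<and>
       a1 * real (m n) powr (1 / \<tau>) \<le> real n \<and> real n \<le> a2 * real (m n) powr (1 / \<tau>)"
    define r where "r = (2 * (1 + \<gamma>) * \<tau> - 1 - s) / (1 + 2 * \<gamma>)"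
    have r: "r > 0"
      using s pos by (simp add: r_def)
    \<comment> \<open>From \<tau> <= 1 and \<gamma> > -1/2 it follows that r < 1 + s, so k * n powr
      (-(1 + s)) tends to 0 and d <= 1 for large n.\<close>
    have "(1 + \<gamma>) * \<tau> \<le> (1 + \<gamma>) * 1"
      using \<tau> pos by (intro mult_left_mono) auto
    moreover have "(1 + 2 * \<gamma>) * s > -s"
      using s pos by (smt (verit) mult_pos_pos)
    ultimately have "2 * (1 + \<gamma>) * \<tau> - 1 - s < (1 + s) * (1 + 2 * \<gamma>)"
      by (simp add: algebra_simps)
    then have r': "r - (1 + s) < 0"
      using pos by (simp add: r_def divide_less_eq)
    have "((\<lambda>n. 2 / c * real n powr (-r)) \<longlongrightarrow> 2 / c * 0) sequentially"
      using r by (intro tendsto_intros tendsto_neg_powr filterlim_real_sequentially) simp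
    then have "\<forall>\<^sub>F n in sequentially. 2 / c * real n powr (-r) < 1"
      by (intro order_tendstoD(2)) auto
    then have "\<forall>\<^sub>F n in sequentially. c * real n powr r \<ge> 2"
      using eventually_gt_at_top[of 0]
      by eventually_elim (use c in \<open>simp add: powr_minus field_simps\<close>)
    moreover have "((\<lambda>n. c * real n powr (r - (1 + s))) \<longlongrightarrow> c * 0) sequentially"
      using r' by (intro tendsto_intros tendsto_neg_powr filterlim_real_sequentially)
    then have "\<forall>\<^sub>F n in sequentially. c * real n powr (r - (1 + s)) < 1"
      by (intro order_tendstoD(2)) auto
    ultimately show "\<forall>\<^sub>F n in sequentially.
       \<exists>A \<in> sets (sample_measure \<alpha> \<beta> n).
         measure (sample_measure \<alpha> \<beta> n) A \<ge> 1 - 2 * (exp 1)\<^sup>2 * cbar / real n powr s \<and>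
         (\<forall>x\<in>A. cond_number (jacobi_measure \<alpha> \<beta>) (m n) n x \<ge>
            ereal (\<eta> / real n powr ((1 + \<gamma>) * \<tau>) *
              exp (c / 2) powr (real n powr ((2 * (1 + \<gamma>) * \<tau> - 1 - s) / (1 + 2 * \<gamma>)))))"
      using ev eventually_gt_at_top[of 0] unfolding r_def[symmetric]
    proof eventually_elim
      case (elim n)
      then show ?case
        using \<tau> by (intro main) (auto simp: r_def)
    qed
  qed (use c in auto)
qed

end
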